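(* Let $w_1,\dots,w_n\in\mathbb{R}^3$ be vectors whose projections $u_k=\pi(w_k)$ to the $xy$-plane satisfy $u_1+\dots+u_n=0$. Then there is an ordering $\sigma$ of the vectors such that every embedded realization of $(u_1,\dots,u_n)$ in the order $\sigma$ is the unknot.
   Context: Let $\pi:\mathbb{R}^3\to\mathbb{R}^2$, $(x,y,z)\mapsto(x,y)$, be the projection to the $xy$-plane. Let $u_1,\dots,u_n\in\mathbb{R}^2$ have sum $0$ and let $\sigma$ be a permutation of $\{1,\dots,n\}$. A realization of these vectors in the order $\sigma$ is a closed polygonal curve in $\mathbb{R}^3$ with vertices $p_0,p_1,\dots,p_n=p_0$ such that $\pi(p_k-p_{k-1})=u_{\sigma(k)}$ for $k=1,\dots,n$. Equivalently, the vectors are placed tip-to-tail in the plane in the order $\sigma$, and heights ($z$-coordinates) are chosen arbitrarily for the vertices. A realization is embedded if it is a simple closed curve, in which case it is a knot. *)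

theory Defs
  imports "HOL-Analysis.Analysis"
begin

definition proj :: "real \<times> real \<times> real \<Rightarrow> real \<times> real" where
  "proj q = (fst q, fst (snd q))"

definition realization ::
  "nat \<Rightarrow> (nat \<Rightarrow> real \<times> real) \<Rightarrow> (nat \<Rightarrow> nat) \<Rightarrow> (nat \<Rightarrow> real \<times> real \<times> real) \<Rightarrow> bool" where
  "realization n u \<sigma> p \<longleftrightarrow> p n = p 0 \<and> (\<forall>k\<in>{1..n}. proj (p k - p (k - 1)) = u (\<sigma> k))"

definition polygon :: "nat \<Rightarrow> (nat \<Rightarrow> real \<times> real \<times> real) \<Rightarrow> (real \<times> real \<times> real) set" where
  "polygon n p = (\<Union>k\<in>{1..n}. closed_segment (p (k - 1)) (p k))"

definition embedded :: "nat \<Rightarrow> (nat \<Rightarrow> real \<times> real \<times> real) \<Rightarrow> bool" where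
  "embedded n p \<longleftrightarrow> (\<exists>f g. homeomorphism (sphere (0::real \<times> real) 1) (polygon n p) f g)"

definition std_circle :: "(real \<times> real \<times> real) set" where
  "std_circle = {(x, y, z). x\<^sup>2 + y\<^sup>2 = 1 \<and> z = 0}"

definition is_unknot :: "(real \<times> real \<times> real) set \<Rightarrow> bool" where
  "is_unknot K \<longleftrightarrow>
     (\<exists>H :: real \<times> (real \<times> real \<times> real) \<Rightarrow> real \<times> real \<times> real.
        continuous_on ({0..1} \<times> UNIV) H \<and>
        (\<forall>x. H (0, x) = x) \<and>
        (\<forall>t\<in>{0..1}. \<exists>g. homeomorphism UNIV UNIV (\<lambda>x. H (t, x)) g) \<and>
        (\<lambda>x. H (1, x)) ` K = std_circle)"

end

theory Submission
  imports Defs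
begin

text \<open>
Choose linear coordinates \<open>(t, s)\<close> of the plane in which every nonzero vector has \<open>t \<noteq> 0\<close> and the
vectors with \<open>t > 0\<close> have \<open>s\<close>-sum zero. Place first the vectors with \<open>t > 0\<close> (those with \<open>s \<le> 0\<close>
before those with \<open>s > 0\<close>), then those with \<open>t < 0\<close> (\<open>s \<ge> 0\<close> before \<open>s < 0\<close>), and finally the zero
vectors. Every realization consists of two graphs over a \<open>t\<close>-interval, \<open>P(t) = (f(t), a(t))\<close> and
\<open>Q(t) = (g(t), b(t))\<close> in the \<open>(s, z)\<close>-coordinates with \<open>f \<le> g\<close>, and a vertical part over the left end.
Since a circle has no cut points, an embedded realization has \<open>P \<noteq> Q\<close> in the interior, and its
vertical part is exactly the segment joining the left end points. The shear
\<open>s \<mapsto> s + (b(t) - a(t)) z\<close> changes \<open>g - f\<close> into \<open>(g - f) + (b - a)\<^sup>2 > 0\<close>, so afterwards the loop is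
a graph over the boundary of a planar region \<open>{f \<le> s \<le> g}\<close>, can be flattened into the plane, and
can be reshaped into a round circle by homeomorphisms preserving lines.
\<close>

section \<open>Ambient isotopy\<close>

definition ambient_isotopic ::
  "(real \<times> real \<times> real) set \<Rightarrow> (real \<times> real \<times> real) set \<Rightarrow> bool" where
  "ambient_isotopic K L \<longleftrightarrow>
     (\<exists>H :: real \<times> (real \<times> real \<times> real) \<Rightarrow> real \<times> real \<times> real.
        continuous_on ({0..1} \<times> UNIV) H \<and>
        (\<forall>x. H (0, x) = x) \<and>
        (\<forall>t\<in>{0..1}. \<exists>g. homeomorphism UNIV UNIV (\<lambda>x. H (t, x)) g) \<and>
        (\<lambda>x. H (1, x)) ` K = L)"

lemma is_unknot_iff: "is_unknot K \<longleftrightarrow> ambient_isotopic K std_circle"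
  by (simp add: is_unknot_def ambient_isotopic_def)

lemma ambient_isotopic_trans:
  assumes "ambient_isotopic K L" "ambient_isotopic L M"
  shows "ambient_isotopic K M"
proof -
  obtain G :: "real \<times> (real \<times> real \<times> real) \<Rightarrow> real \<times> real \<times> real"
    where G: "continuous_on ({0..1} \<times> UNIV) G" "\<And>x. G (0, x) = x"
      "\<And>t. t \<in> {0..1} \<Longrightarrow> \<exists>g. homeomorphism UNIV UNIV (\<lambda>x. G (t, x)) g" "(\<lambda>x. G (1, x)) ` K = L"
    using assms(1) unfolding ambient_isotopic_def by blast
  obtain H :: "real \<times> (real \<times> real \<times> real) \<Rightarrow> real \<times> real \<times> real"
    where H: "continuous_on ({0..1} \<times> UNIV) H" "\<And>x. H (0, x) = x"
      "\<And>t. t \<in> {0..1} \<Longrightarrow> \<exists>g. homeomorphism UNIV UNIV (\<lambda>x. H (t, x)) g" "(\<lambda>x. H (1, x)) ` L = M"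
    using assms(2) unfolding ambient_isotopic_def by blast
  \<comment> \<open>The two isotopies are composed level by level in time rather than concatenated,
    so no gluing at an intermediate time is needed.\<close>
  let ?F = "\<lambda>z. H (fst z, G z)"
  have "continuous_on ({0..1} \<times> UNIV) ?F"
    by (rule continuous_on_compose2[OF H(1)]) (auto intro!: continuous_intros G(1))
  moreover have "\<exists>g. homeomorphism UNIV UNIV (\<lambda>x. ?F (t, x)) g" if t: "t \<in> {0..1}" for t
  proof -
    obtain g h where "homeomorphism UNIV UNIV (\<lambda>x. G (t, x)) g" "homeomorphism UNIV UNIV (\<lambda>x. H (t, x)) h"
      using G(3)[OF t] H(3)[OF t] by blast
    then have "homeomorphism UNIV UNIV ((\<lambda>x. H (t, x)) \<circ> (\<lambda>x. G (t, x))) (g \<circ> h)"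
      by (rule homeomorphism_compose)
    then show ?thesis by (auto simp: o_def)
  qed
  moreover have "(\<lambda>x. ?F (1, x)) ` K = M"
    using G(4) H(4) by (auto simp: image_image)
  ultimately show ?thesis
    unfolding ambient_isotopic_def using G(2) H(2) by (intro exI[of _ ?F]) simp
qed

text \<open>The isotopy moves \<open>x\<close> in a straight line by \<open>t * \<phi> x\<close>
  along \<open>e\<close>. On each line parallel to \<open>e\<close> it interpolates between the
  identity and an increasing bijection, so it stays an increasing bijection at every time. Every
  isotopy below is built from such maps, one direction at a time.\<close>

lemma ambient_isotopic_fibrewise:
  fixes \<phi> :: "real \<times> real \<times> real \<Rightarrow> real"
  assumes cont: "continuous_on UNIV \<phi>" and e: "e \<noteq> 0"
    and mono: "\<And>x r s. r < s \<Longrightarrow> r + \<phi> (x + r *\<^sub>R e) < s + \<phi> (x + s *\<^sub>R e)"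
    and surj: "\<And>x v. \<exists>r. r + \<phi> (x + r *\<^sub>R e) = v"
  shows "ambient_isotopic K ((\<lambda>x. x + \<phi> x *\<^sub>R e) ` K)"
proof -
  let ?H = "\<lambda>z. snd z + (fst z * \<phi> (snd z)) *\<^sub>R e"
  have contH: "continuous_on S ?H" for S
    by (intro continuous_intros continuous_on_compose2[OF cont]) auto
  have mono': "r + t * \<phi> (x + r *\<^sub>R e) < s + t * \<phi> (x + s *\<^sub>R e)"
    if "r < s" "t \<in> {0..1}" for r s t x
  proof -
    have "(1 - t) * r + t * (r + \<phi> (x + r *\<^sub>R e)) < (1 - t) * s + t * (s + \<phi> (x + s *\<^sub>R e))"
    proof (cases "t = 0")
      case False
      with that show ?thesis
        by (intro add_le_less_mono mult_left_mono mult_strict_left_mono[OF mono[OF that(1)]]) auto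
    qed (use that in auto)
    then show ?thesis by (simp add: algebra_simps)
  qed
  have "\<exists>g. homeomorphism UNIV UNIV (\<lambda>x. ?H (t, x)) g" if t: "t \<in> {0..1}" for t
  proof -
    have contt: "continuous_on UNIV (\<lambda>x. ?H (t, x))"
      by (intro continuous_on_compose2[OF contH[of UNIV]] continuous_intros) auto
    have inj: "inj (\<lambda>x. ?H (t, x))"
    proof (rule injI)
      fix x x' assume eq: "?H (t, x) = ?H (t, x')"
      define r where "r = t * \<phi> x - t * \<phi> x'"
      have x': "x' = x + r *\<^sub>R e" using eq by (simp add: r_def algebra_simps)
      then have "r + t * \<phi> (x + r *\<^sub>R e) = 0 + t * \<phi> (x + 0 *\<^sub>R e)"
        by (simp add: r_def)
      then have "r = 0" using mono'[OF _ t, of r 0 x] mono'[OF _ t, of 0 r x] by (cases r "0::real" rule: linorder_cases) auto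
      then show "x = x'" using x' by simp
    qed
    have "y \<in> range (\<lambda>x. ?H (t, x))" for y
    proof -
      let ?\<rho> = "\<lambda>r. r + t * \<phi> (y + r *\<^sub>R e)"
      \<comment> \<open>At time 0 the fibre map vanishes at 0, at time 1 it vanishes at
        \<open>r1\<close>. For intermediate times its zero lies between the two, and the
        intermediate value theorem finds it on the interval from \<open>min r1 0\<close> to
        \<open>max r1 0\<close>.\<close>
      obtain r1 where r1: "r1 + \<phi> (y + r1 *\<^sub>R e) = 0" using surj[of y 0] by auto
      have split: "?\<rho> r = (1 - t) * r + t * (r + \<phi> (y + r *\<^sub>R e))" for r
        by (simp add: algebra_simps)
      have "?\<rho> (min r1 0) \<le> 0"
      proof -
        have "min r1 0 + \<phi> (y + min r1 0 *\<^sub>R e) \<le> 0"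
          proof (cases "0 < r1")
            case True
            then show ?thesis using mono[OF True, of y] r1 by simp
          next
            case False
            then show ?thesis using r1 by (simp add: min_def)
          qed
        with t have "t * (min r1 0 + \<phi> (y + min r1 0 *\<^sub>R e)) \<le> 0" "(1 - t) * min r1 0 \<le> 0"
          by (simp_all add: mult_nonneg_nonpos)
        then show ?thesis unfolding split by linarith
      qed
      moreover have "0 \<le> ?\<rho> (max r1 0)"
      proof -
        have "0 \<le> max r1 0 + \<phi> (y + max r1 0 *\<^sub>R e)"
          proof (cases "r1 < 0")
            case True
            then show ?thesis using mono[OF True, of y] r1 by simp
          next
            case False
            then show ?thesis using r1 by (simp add: max_def)
          qed
        with t have "0 \<le> t * (max r1 0 + \<phi> (y + max r1 0 *\<^sub>R e))" "0 \<le> (1 - t) * max r1 0"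
          by simp_all
        then show ?thesis unfolding split by linarith
      qed
      moreover have "continuous_on {min r1 0..max r1 0} ?\<rho>"
        by (intro continuous_intros continuous_on_compose2[OF cont]) auto
      ultimately obtain r where "?\<rho> r = 0"
        using IVT'[of ?\<rho> "min r1 0" 0 "max r1 0"] by (auto simp: min_def max_def split: if_splits)
      then have "?H (t, y + r *\<^sub>R e) = y"
        by (simp add: add.assoc flip: scaleR_add_left)
      then show ?thesis
        by (intro range_eqI[of y "\<lambda>x. ?H (t, x)" "y + r *\<^sub>R e"]) (rule sym)
    qed
    then have range: "range (\<lambda>x. ?H (t, x)) = UNIV" by blast
    \<comment> \<open>Invariance of domain supplies continuity of the inverse, which is not read off
      from the fibres.\<close>
    from invariance_of_domain_homeomorphism[OF open_UNIV contt order_refl inj]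
    show ?thesis unfolding range by blast
  qed
  then show ?thesis
    unfolding ambient_isotopic_def by (intro exI[of _ ?H] conjI ballI contH) auto
qed

section \<open>Exchanging the two horizontal axes\<close>

definition swap_xy :: "real \<times> real \<times> real \<Rightarrow> real \<times> real \<times> real" where
  "swap_xy q = (fst (snd q), fst q, snd (snd q))"

lemma swap_xy_swap_xy [simp]: "swap_xy (swap_xy q) = q"
  by (simp add: swap_xy_def)

lemma image_swap_eqI:
  assumes "\<And>x. swap_xy x \<in> B \<longleftrightarrow> x \<in> A"
  shows "swap_xy ` A = B"
proof
  show "B \<subseteq> swap_xy ` A"
  proof
    fix x assume "x \<in> B"
    then have "swap_xy x \<in> A" using assms[of "swap_xy x"] by simp
    from imageI[OF this, of swap_xy] show "x \<in> swap_xy ` A" by simp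
  qed
qed (use assms in auto)

lemma continuous_on_swap_xy [continuous_intros]:
  "continuous_on S f \<Longrightarrow> continuous_on S (\<lambda>x. swap_xy (f x))"
  unfolding swap_xy_def by (intro continuous_intros)

lemma homeomorphism_swap_xy: "homeomorphism UNIV UNIV swap_xy swap_xy"
  by (auto simp: homeomorphism_def intro!: continuous_intros surjI[of swap_xy swap_xy])

lemma ambient_isotopic_swap_xy:
  assumes "ambient_isotopic K L"
  shows "ambient_isotopic (swap_xy ` K) (swap_xy ` L)"
proof -
  obtain H :: "real \<times> (real \<times> real \<times> real) \<Rightarrow> real \<times> real \<times> real"
    where H: "continuous_on ({0..1} \<times> UNIV) H" "\<And>x. H (0, x) = x"
      "\<And>t. t \<in> {0..1} \<Longrightarrow> \<exists>g. homeomorphism UNIV UNIV (\<lambda>x. H (t, x)) g" "(\<lambda>x. H (1, x)) ` K = L"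
    using assms unfolding ambient_isotopic_def by blast
  let ?F = "\<lambda>z. swap_xy (H (fst z, swap_xy (snd z)))"
  have "continuous_on ({0..1} \<times> UNIV) ?F"
    by (intro continuous_intros continuous_on_compose2[OF H(1)]) auto
  moreover have "\<exists>g. homeomorphism UNIV UNIV (\<lambda>x. ?F (t, x)) g" if t: "t \<in> {0..1}" for t
  proof -
    obtain g where "homeomorphism UNIV UNIV (\<lambda>x. H (t, x)) g"
      using H(3)[OF t] by blast
    then have "homeomorphism UNIV UNIV (swap_xy \<circ> ((\<lambda>x. H (t, x)) \<circ> swap_xy)) ((swap_xy \<circ> g) \<circ> swap_xy)"
      by (intro homeomorphism_compose[OF homeomorphism_compose[OF homeomorphism_swap_xy] homeomorphism_swap_xy])
    then show ?thesis by (auto simp: o_def)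
  qed
  moreover have "(\<lambda>x. ?F (1, x)) ` swap_xy ` K = swap_xy ` L"
    using H(4) by (auto simp: image_image)
  ultimately show ?thesis
    unfolding ambient_isotopic_def using H(2) by (intro exI[of _ ?F]) simp
qed

section \<open>Boundaries of planar bands\<close>

text \<open>The increasing piecewise linear bijection of the line carrying \<open>[a, b]\<close> to \<open>[a', b']\<close>, with slope 1 outside \<open>[a, b]\<close>. If \<open>a = b\<close>, the junk value \<open>x / 0 = 0\<close> removes the last summand.\<close>

definition refit :: "real \<Rightarrow> real \<Rightarrow> real \<Rightarrow> real \<Rightarrow> real \<Rightarrow> real" where
  "refit a b a' b' y =
     a' + min (y - a) 0 + max (y - b) 0 + min (max (y - a) 0) (b - a) * (b' - a') / (b - a)"

context
  fixes a b a' b' :: real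
  assumes le: "a \<le> b" "a' \<le> b'" and degenerate: "a = b \<longleftrightarrow> a' = b'"
begin

text \<open>The clamped pieces \<open>m\<close>, \<open>M\<close>, \<open>c\<close> are
  nondecreasing and add up to \<open>x - a\<close>; \<open>refit\<close> only rescales
  \<open>c\<close> by the slope \<open>\<rho>\<close>. If \<open>c\<close> grows, then
  \<open>a < b\<close> and the slope is positive; if it does not, the growth lies in
  \<open>m + M\<close>, which is kept unscaled.\<close>

lemma refit_strict_mono:
  assumes "y < z"
  shows "refit a b a' b' y < refit a b a' b' z"
proof -
  define m where "m x = min (x - a) 0" for x
  define M where "M x = max (x - b) 0" for x
  define c where "c x = min (max (x - a) 0) (b - a)" for x
  define \<rho> where "\<rho> = (b' - a') / (b - a)"
  have refit_eq: "refit a b a' b' x = a' + m x + M x + c x * \<rho>" for x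
    by (simp add: refit_def m_def M_def c_def \<rho>_def)
  have part: "m x + M x + c x = x - a" for x
    using le by (auto simp: m_def M_def c_def min_def max_def)
  have mono: "m y \<le> m z" "M y \<le> M z" "c y \<le> c z"
    using assms by (auto simp: m_def M_def c_def)
  have \<rho>: "0 \<le> \<rho>" using le by (simp add: \<rho>_def)
  show ?thesis
  proof (cases "c y < c z")
    case True
    then have "a < b" using le by (auto simp: c_def min_def max_def split: if_splits)
    then have "0 < \<rho>" unfolding \<rho>_def using le degenerate by (intro divide_pos_pos) auto
    from mult_strict_right_mono[OF True this] show ?thesis
      unfolding refit_eq using mono(1,2) by linarith
  next
    case False
    then have "c y = c z" using mono by simp
    then show ?thesis unfolding refit_eq using mono part[of y] part[of z] assms by simp
  qed
qed

lemma refit_less_iff: "refit a b a' b' y < refit a b a' b' z \<longleftrightarrow> y < z"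
  using refit_strict_mono by (metis linorder_neqE_linordered_idom order_less_asym order_less_irrefl)

lemma refit_le_iff: "refit a b a' b' y \<le> refit a b a' b' z \<longleftrightarrow> y \<le> z"
  using refit_less_iff by (metis linorder_not_less)

lemma refit_eq_iff: "refit a b a' b' y = refit a b a' b' z \<longleftrightarrow> y = z"
  by (simp add: order_eq_iff refit_le_iff)

lemma refit_left: "refit a b a' b' a = a'"
  using le by (simp add: refit_def)

lemma refit_right: "refit a b a' b' b = b'"
  using le degenerate by (cases "a = b") (auto simp: refit_def)

lemma refit_surj: "\<exists>y. refit a b a' b' y = v"
proof -
  consider "v \<le> a'" | "b' \<le> v" | "a' < v" "v < b'" by linarith
  then show ?thesis
  proof cases
    case 1
    then have "refit a b a' b' (a + (v - a')) = v" using le by (auto simp: refit_def)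
    then show ?thesis ..
  next
    case 2
    then have "refit a b a' b' (b + (v - b')) = v"
      using le degenerate by (cases "a = b") (auto simp: refit_def)
    then show ?thesis ..
  next
    case 3
    define d where "d = (v - a') * (b - a) / (b' - a')"
    have ab: "a < b" using 3 le degenerate by auto
    have d: "0 \<le> d" "d \<le> b - a" 
      using 3 ab by (auto simp: d_def divide_simps mult.commute intro!: mult_right_mono)
    then have "refit a b a' b' (a + d) = v" using 3 ab by (simp add: refit_def) (simp add: d_def)
    then show ?thesis ..
  qed
qed

end

text \<open>This is the middle summand of \<open>refit\<close> with varying interval widths
  \<open>w\<close> and \<open>w'\<close>. Where \<open>w\<close> vanishes the quotient has the
  default value 0, and it is continuous there because \<open>c \<le> w\<close> bounds it by
  \<open>w'\<close>, which tends to 0.\<close>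

lemma continuous_on_scaled:
  fixes c w w' :: "'a::metric_space \<Rightarrow> real"
  assumes cont: "continuous_on UNIV c" "continuous_on UNIV w" "continuous_on UNIV w'"
    and c: "\<And>x. 0 \<le> c x" "\<And>x. c x \<le> w x" and w': "\<And>x. 0 \<le> w' x"
    and zero: "\<And>x. w x = 0 \<longleftrightarrow> w' x = 0"
  shows "continuous_on UNIV (\<lambda>x. c x * w' x / w x)"
proof (rule continuous_at_imp_continuous_on, rule ballI)
  fix x
  have tends: "c \<midarrow>x\<rightarrow> c x" "w \<midarrow>x\<rightarrow> w x" "w' \<midarrow>x\<rightarrow> w' x"
    using cont by (auto simp: continuous_on_def)
  show "isCont (\<lambda>x. c x * w' x / w x) x"
  proof (cases "w x = 0")
    case False
    then show ?thesis using tends unfolding isCont_def by (intro tendsto_intros)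
  next
    case True
    have "norm (c y * w' y / w y) \<le> w' y" for y
    proof (cases "w y = 0")
      case False
      then have "0 < w y" using c[of y] by linarith
      then show ?thesis using c[of y] w'[of y] by (simp add: divide_simps mult.commute[of "w' y"] mult_right_mono)
    qed (use w' in auto)
    then have "\<forall>\<^sub>F y in at x. norm (c y * w' y / w y) \<le> w' y" by (simp add: always_eventually)
    moreover have "w' \<midarrow>x\<rightarrow> 0" using tends(3) True zero by simp
    ultimately have "(\<lambda>x. c x * w' x / w x) \<midarrow>x\<rightarrow> 0"
      by (rule Lim_null_comparison)
    then show ?thesis using True by (simp add: isCont_def)
  qed
qed

text \<open>The boundary curve of the planar region between two graphs, including its vertical sides
  at \<open>l\<close> and \<open>r\<close>. A side collapses to a point where the two functions
  agree.\<close>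

definition band ::
  "real \<Rightarrow> real \<Rightarrow> (real \<Rightarrow> real) \<Rightarrow> (real \<Rightarrow> real) \<Rightarrow> (real \<times> real \<times> real) set" where
  "band l r \<alpha> \<beta> = {(t, y, z). z = 0 \<and> l \<le> t \<and> t \<le> r \<and> \<alpha> t \<le> y \<and> y \<le> \<beta> t \<and>
     (t = l \<or> t = r \<or> y = \<alpha> t \<or> y = \<beta> t)}"

lemma band_cong:
  assumes "\<And>t. l \<le> t \<Longrightarrow> t \<le> r \<Longrightarrow> \<alpha> t = \<alpha>' t" "\<And>t. l \<le> t \<Longrightarrow> t \<le> r \<Longrightarrow> \<beta> t = \<beta>' t"
  shows "band l r \<alpha> \<beta> = band l r \<alpha>' \<beta>'"
  unfolding band_def using assms by auto

text \<open>On each line in the second direction, \<open>refit\<close> carries one interval to the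
  other. An injective map cannot collapse or create an interval, so the degenerate fibres must
  match. The hypotheses range over all \<open>t\<close> because the map acts on the whole
  space.\<close>

lemma ambient_isotopic_band:
  assumes cont: "continuous_on UNIV \<alpha>" "continuous_on UNIV \<beta>"
      "continuous_on UNIV \<alpha>'" "continuous_on UNIV \<beta>'"
    and le: "\<And>t. \<alpha> t \<le> \<beta> t" "\<And>t. \<alpha>' t \<le> \<beta>' t"
    and deg: "\<And>t. \<alpha> t = \<beta> t \<longleftrightarrow> \<alpha>' t = \<beta>' t"
  shows "ambient_isotopic (band l r \<alpha> \<beta>) (band l r \<alpha>' \<beta>')"
proof -
  let ?R = "\<lambda>t y. refit (\<alpha> t) (\<beta> t) (\<alpha>' t) (\<beta>' t) y"
  let ?\<phi> = "\<lambda>x :: real \<times> real \<times> real. ?R (fst x) (fst (snd x)) - fst (snd x)"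
  let ?e = "(0, 1, 0) :: real \<times> real \<times> real"
  have fst_cont: "continuous_on UNIV (\<lambda>x :: real \<times> real \<times> real. f (fst x))"
    if "continuous_on UNIV f" for f :: "real \<Rightarrow> real"
    by (rule continuous_on_compose2[OF that]) (auto intro: continuous_intros)
  note comp = cont[THEN fst_cont]
  have "continuous_on UNIV (\<lambda>x :: real \<times> real \<times> real.
      min (max (fst (snd x) - \<alpha> (fst x)) 0) (\<beta> (fst x) - \<alpha> (fst x)) * (\<beta>' (fst x) - \<alpha>' (fst x))
        / (\<beta> (fst x) - \<alpha> (fst x)))" (is "continuous_on UNIV ?\<kappa>")
  proof (rule continuous_on_scaled)
    show "\<beta> (fst x) - \<alpha> (fst x) = 0 \<longleftrightarrow> \<beta>' (fst x) - \<alpha>' (fst x) = 0" for x :: "real \<times> real \<times> real"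
      using deg[of "fst x"] by auto
  qed (use le in \<open>auto intro!: continuous_intros comp\<close>)
  then have "continuous_on UNIV ?\<phi>"
    unfolding refit_def by (intro continuous_on_add continuous_on_diff continuous_on_min continuous_on_max
        continuous_on_fst continuous_on_snd continuous_on_id continuous_on_const comp)
  moreover have "r + ?\<phi> (x + r *\<^sub>R ?e) < s + ?\<phi> (x + s *\<^sub>R ?e)" if "r < s" for x r s
    using refit_strict_mono[OF le(1) le(2) deg, of "fst (snd x) + r" "fst (snd x) + s" "fst x"] that
    by simp
  moreover have "\<exists>r. r + ?\<phi> (x + r *\<^sub>R ?e) = v" for x v
  proof -
    obtain t y z where x: "x = (t, y, z)" by (cases x)
    obtain y' where "?R t y' = y + v" using refit_surj[OF le deg] by blast
    then show ?thesis unfolding x by (intro exI[of _ "y' - y"]) simp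
  qed
  moreover have "?e \<noteq> 0" by (simp add: zero_prod_def)
  ultimately have iso: "ambient_isotopic (band l r \<alpha> \<beta>) ((\<lambda>x. x + ?\<phi> x *\<^sub>R ?e) ` band l r \<alpha> \<beta>)"
    by (intro ambient_isotopic_fibrewise[where \<phi> = ?\<phi> and e = ?e])
  \<comment> \<open>Since \<open>refit\<close> preserves order and matches endpoints, every
    condition in the definition of \<open>band\<close> translates into its counterpart.\<close>
  have mem: "(t, ?R t y, z) \<in> band l r \<alpha>' \<beta>' \<longleftrightarrow> (t, y, z) \<in> band l r \<alpha> \<beta>" for t y z
  proof -
    note le_iff = refit_le_iff[OF le(1)[of t] le(2)[of t] deg[of t]]
      and eq_iff = refit_eq_iff[OF le(1)[of t] le(2)[of t] deg[of t]]
      and left = refit_left[OF le(1)[of t] le(2)[of t] deg[of t]]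
      and right = refit_right[OF le(1)[of t] le(2)[of t] deg[of t]]
    show ?thesis
      unfolding band_def mem_Collect_eq prod.case
        le_iff[of "\<alpha> t" y, unfolded left] le_iff[of y "\<beta> t", unfolded right]
        eq_iff[of y "\<alpha> t", unfolded left] eq_iff[of y "\<beta> t", unfolded right] ..
  qed
  have "(\<lambda>x. x + ?\<phi> x *\<^sub>R ?e) ` band l r \<alpha> \<beta> = band l r \<alpha>' \<beta>'"
  proof (intro equalityI subsetI)
    fix q assume "q \<in> band l r \<alpha>' \<beta>'"
    moreover obtain t y z where "q = (t, y, z)" by (cases q)
    moreover obtain y' where "?R t y' = y" using refit_surj[OF le deg] by blast
    ultimately show "q \<in> (\<lambda>x. x + ?\<phi> x *\<^sub>R ?e) ` band l r \<alpha> \<beta>"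
      using mem[of t y' z] by (intro image_eqI[of _ _ "(t, y', z)"]) auto
  qed (use mem in auto)
  with iso show ?thesis by simp
qed

text \<open>The truncation \<open>max 0\<close> extends the half circles by zero. The two functions
  are then continuous on the whole line and agree exactly outside the open interval from -1 to
  1.\<close>

lemma std_circle_eq_band:
  "std_circle = band (-1) 1 (\<lambda>t. - sqrt (max 0 (1 - t\<^sup>2))) (\<lambda>t. sqrt (max 0 (1 - t\<^sup>2)))"
proof -
  have "x\<^sup>2 + y\<^sup>2 = 1 \<longleftrightarrow> -1 \<le> x \<and> x \<le> 1 \<and> (y = - sqrt (1 - x\<^sup>2) \<or> y = sqrt (1 - x\<^sup>2))" for x y :: real
  proof -
    have "-1 \<le> x \<and> x \<le> 1 \<longleftrightarrow> x\<^sup>2 \<le> 1" by (auto simp: abs_square_le_1 abs_le_iff)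
    moreover have "y\<^sup>2 = 1 - x\<^sup>2 \<longleftrightarrow> y = - sqrt (1 - x\<^sup>2) \<or> y = sqrt (1 - x\<^sup>2)" if "x\<^sup>2 \<le> 1"
      using that by (metis diff_ge_0_iff_ge power2_eq_iff real_sqrt_pow2)
    moreover have "x\<^sup>2 + y\<^sup>2 = 1 \<Longrightarrow> x\<^sup>2 \<le> 1" using zero_le_power2[of y] by linarith
    ultimately show ?thesis by (smt (verit))
  qed
  moreover have "max 0 (1 - x\<^sup>2) = 1 - x\<^sup>2" if "-1 \<le> x" "x \<le> 1" for x :: real
    using that by (simp add: abs_square_le_1 abs_le_iff)
  ultimately show ?thesis
    by (auto simp: std_circle_def band_def abs_square_le_1 abs_le_iff)
qed

lemma ambient_isotopic_band_unit:
  assumes cont: "continuous_on UNIV \<alpha>" "continuous_on UNIV \<beta>"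
    and less: "\<And>t. -1 < t \<Longrightarrow> t < 1 \<Longrightarrow> \<alpha> t < \<beta> t" and ends: "\<alpha> (-1) \<le> \<beta> (-1)" "\<alpha> 1 = \<beta> 1"
  shows "ambient_isotopic (band (-1) 1 \<alpha> \<beta>) std_circle"
proof -
  \<comment> \<open>Precomposing with the clamp leaves the band unchanged and freezes the boundary
    functions at their end values outside the interval. The fibres outside are then degenerate
    exactly when the corresponding end is.\<close>
  define cl where "cl t = max (-1) (min 1 t)" for t :: real
  have cl: "continuous_on UNIV cl" unfolding cl_def by (intro continuous_intros)
  have cl_cases: "t \<le> -1 \<and> cl t = -1 \<or> 1 \<le> t \<and> cl t = 1 \<or> -1 < t \<and> t < 1 \<and> cl t = t" for t
    by (auto simp: cl_def)
  let ?a = "\<lambda>t. \<alpha> (cl t)" and ?b = "\<lambda>t. \<beta> (cl t)"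
  have eq: "band (-1) 1 \<alpha> \<beta> = band (-1) 1 ?a ?b"
    by (rule band_cong) (auto simp: cl_def)
  have ab: "continuous_on UNIV ?a" "continuous_on UNIV ?b"
    by (intro continuous_on_compose2[OF cont(1) cl] continuous_on_compose2[OF cont(2) cl]; simp)+
  have le: "?a t \<le> ?b t" for t
    using cl_cases[of t] less[of t] ends by (elim disjE conjE) simp_all
  have sq: "t\<^sup>2 < 1 \<longleftrightarrow> -1 < t \<and> t < 1" for t :: real
    by (auto simp: abs_square_less_1 abs_less_iff)
  show ?thesis
  proof (cases "\<alpha> (-1) = \<beta> (-1)")
    case True
    have "?a t = ?b t \<longleftrightarrow> - sqrt (max 0 (1 - t\<^sup>2)) = sqrt (max 0 (1 - t\<^sup>2))" for t
      using cl_cases[of t] less[of t] ends True sq[of t] by (auto simp: max_def)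
    then show ?thesis unfolding eq std_circle_eq_band
      by (intro ambient_isotopic_band ab le continuous_intros) auto
  next
    case False
    txt \<open>With a nondegenerate left side the circle is not a possible target for a map preserving the
      vertical lines. A triangle is, and it becomes a circle by a map preserving horizontal lines.\<close>
    define tri where "tri = band (-1) 1 (\<lambda>t. - (1 - cl t) / 2) (\<lambda>t. (1 - cl t) / 2)"
    have "?a t = ?b t \<longleftrightarrow> - (1 - cl t) / 2 = (1 - cl t) / 2" for t
      using cl_cases[of t] less[of t] ends False by auto
    then have 1: "ambient_isotopic (band (-1) 1 ?a ?b) tri"
      unfolding tri_def
      by (intro ambient_isotopic_band ab le continuous_intros cl) (auto simp: cl_def)
    \<comment> \<open>Seen along the other axis the triangle lies between the constant -1 and
      \<open>1 - 2 * \<bar>y\<bar>\<close>. The truncated functions agree exactly outside the open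
      interval, just as those of the circle do, so the two bands are compatible.\<close>
    have 2: "ambient_isotopic (band (-1) 1 (\<lambda>_. -1) (\<lambda>y. max (-1) (1 - 2 * \<bar>y\<bar>))) std_circle"
      unfolding std_circle_eq_band
    proof (intro ambient_isotopic_band continuous_intros)
      fix y :: real
      show "-1 = max (-1) (1 - 2 * \<bar>y\<bar>) \<longleftrightarrow> - sqrt (max 0 (1 - y\<^sup>2)) = sqrt (max 0 (1 - y\<^sup>2))"
        using sq[of y] by (auto simp: max_def)
    qed auto
    have "swap_xy ` band (-1) 1 (\<lambda>_. -1) (\<lambda>y. max (-1) (1 - 2 * \<bar>y\<bar>)) = tri"
      by (rule image_swap_eqI) (auto simp: band_def tri_def swap_xy_def cl_def split: prod.splits)
    moreover have "swap_xy ` std_circle = std_circle"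
      by (rule image_swap_eqI) (auto simp: std_circle_def swap_xy_def)
    ultimately have "ambient_isotopic tri std_circle"
      using ambient_isotopic_swap_xy[OF 2] by simp
    with 1 show ?thesis unfolding eq by (rule ambient_isotopic_trans)
  qed
qed

lemma band_unknotted:
  assumes cont: "continuous_on UNIV \<alpha>" "continuous_on UNIV \<beta>" and "l < r"
    and less: "\<And>t. l < t \<Longrightarrow> t < r \<Longrightarrow> \<alpha> t < \<beta> t" and ends: "\<alpha> l \<le> \<beta> l" "\<alpha> r = \<beta> r"
  shows "ambient_isotopic (band l r \<alpha> \<beta>) std_circle"
proof -
  define \<tau> where "\<tau> s = ((r - l) * s + l + r) / 2" for s
  define \<nu> where "\<nu> t = (2 * t - l - r) / (r - l)" for t
  have inv: "\<tau> (\<nu> t) = t" "\<nu> (\<tau> t) = t" for t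
  proof -
    show "\<tau> (\<nu> t) = t" using \<open>l < r\<close> by (simp add: \<tau>_def \<nu>_def)
    have "2 * \<tau> t - l - r = (r - l) * t" by (simp add: \<tau>_def field_simps)
    then show "\<nu> (\<tau> t) = t" using \<open>l < r\<close> by (simp add: \<nu>_def)
  qed
  have \<nu>_less: "\<nu> s < \<nu> t \<longleftrightarrow> s < t" for s t using \<open>l < r\<close> by (simp add: \<nu>_def divide_simps)
  then have \<nu>_le: "\<nu> s \<le> \<nu> t \<longleftrightarrow> s \<le> t" for s t by (metis linorder_not_less)
  have \<nu>_ends: "\<nu> l = -1" "\<nu> r = 1" using \<open>l < r\<close> by (auto simp: \<nu>_def divide_simps)
  then have \<tau>_ends: "\<tau> (-1) = l" "\<tau> 1 = r" using inv(1) by metis+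
  let ?\<phi> = "\<lambda>x :: real \<times> real \<times> real. \<nu> (fst x) - fst x"
  let ?e = "(1, 0, 0) :: real \<times> real \<times> real"
  have "continuous_on UNIV ?\<phi>" unfolding \<nu>_def using \<open>l < r\<close> by (intro continuous_intros) auto
  moreover have "r + ?\<phi> (x + r *\<^sub>R ?e) < s + ?\<phi> (x + s *\<^sub>R ?e)" if "r < s" for x r s
    using that \<nu>_less by (cases x) simp
  moreover have "\<exists>r. r + ?\<phi> (x + r *\<^sub>R ?e) = v" for x v
    using inv by (cases x) (auto intro!: exI[of _ "\<tau> (v + fst x) - fst x"])
  moreover have "?e \<noteq> 0" by (simp add: zero_prod_def)
  ultimately have iso: "ambient_isotopic (band l r \<alpha> \<beta>) ((\<lambda>x. x + ?\<phi> x *\<^sub>R ?e) ` band l r \<alpha> \<beta>)"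
    by (intro ambient_isotopic_fibrewise[where \<phi> = ?\<phi> and e = ?e])
  have mem: "(\<nu> t, y, z) \<in> band (-1) 1 (\<alpha> \<circ> \<tau>) (\<beta> \<circ> \<tau>) \<longleftrightarrow> (t, y, z) \<in> band l r \<alpha> \<beta>" for t y z
    using \<nu>_le[of l t] \<nu>_le[of t r] inv(1) \<nu>_ends by (auto simp: band_def) (metis inv(1))+
  have "(\<lambda>x. x + ?\<phi> x *\<^sub>R ?e) ` band l r \<alpha> \<beta> = band (-1) 1 (\<alpha> \<circ> \<tau>) (\<beta> \<circ> \<tau>)"
  proof (intro equalityI subsetI)
    fix q assume "q \<in> band (-1) 1 (\<alpha> \<circ> \<tau>) (\<beta> \<circ> \<tau>)"
    moreover obtain t y z where "q = (t, y, z)" by (cases q)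
    ultimately show "q \<in> (\<lambda>x. x + ?\<phi> x *\<^sub>R ?e) ` band l r \<alpha> \<beta>"
      using mem[of "\<tau> t" y z] by (intro image_eqI[of _ _ "(\<tau> t, y, z)"]) (auto simp: inv)
  qed (use mem in auto)
  moreover have "ambient_isotopic (band (-1) 1 (\<alpha> \<circ> \<tau>) (\<beta> \<circ> \<tau>)) std_circle"
  proof (rule ambient_isotopic_band_unit)
    have "continuous_on UNIV \<tau>" unfolding \<tau>_def by (intro continuous_intros) simp
    then show "continuous_on UNIV (\<alpha> \<circ> \<tau>)" "continuous_on UNIV (\<beta> \<circ> \<tau>)"
      using cont by (auto simp: o_def intro: continuous_on_compose2)
    show "(\<alpha> \<circ> \<tau>) t < (\<beta> \<circ> \<tau>) t" if "-1 < t" "t < 1" for t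
      using that less[of "\<tau> t"] \<nu>_less[of l "\<tau> t"] \<nu>_less[of "\<tau> t" r] by (simp add: inv \<nu>_ends)
  qed (use ends \<tau>_ends in auto)
  ultimately show ?thesis using ambient_isotopic_trans[OF iso] by simp
qed

section \<open>Loops made of two graphs\<close>

text \<open>After the shear by \<open>(b - a) * z\<close> the projection to the plane is injective
  on the loop. Its height is therefore a continuous function of the planar position, and subtracting
  an extension of that function flattens the loop onto a band.\<close>

lemma two_graphs_unknotted:
  fixes f a g b :: "real \<Rightarrow> real"
  assumes cont: "continuous_on UNIV f" "continuous_on UNIV a" "continuous_on UNIV g" "continuous_on UNIV b"
    and "l < r"
    and le: "\<And>t. l \<le> t \<Longrightarrow> t \<le> r \<Longrightarrow> f t \<le> g t"
    and ne: "\<And>t. l < t \<Longrightarrow> t < r \<Longrightarrow> f t = g t \<Longrightarrow> a t \<noteq> b t"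
    and ends: "f l = g l" "f r = g r" "a r = b r"
  shows "ambient_isotopic ((\<lambda>t. (t, f t, a t)) ` {l..r} \<union> (\<lambda>t. (t, g t, b t)) ` {l..r} \<union>
    (\<lambda>z. (l, f l, z)) ` closed_segment (a l) (b l)) std_circle" (is "ambient_isotopic ?K _")
proof -
  define F where "F t = f t + (b t - a t) * a t" for t
  define G where "G t = g t + (b t - a t) * b t" for t
  define d where "d = b l - a l"
  have contFG: "continuous_on UNIV F" "continuous_on UNIV G"
    unfolding F_def G_def by (intro continuous_intros cont)+
  have diff: "G t - F t = (g t - f t) + (b t - a t)\<^sup>2" for t
    by (simp add: F_def G_def power2_eq_square algebra_simps)
  have FG_le: "F t \<le> G t" if "l \<le> t" "t \<le> r" for t
    using diff[of t] le[OF that] zero_le_power2[of "b t - a t"] by linarith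
  have FG_less: "F t < G t" if "l < t" "t < r" for t
  proof (cases "f t = g t")
    case True
    then have "0 < (b t - a t)\<^sup>2" using ne[OF that] by auto
    then show ?thesis using diff[of t] True by linarith
  next
    case False
    then show ?thesis
      using diff[of t] le[of t] that zero_le_power2[of "b t - a t"] by linarith
  qed
  have FG_ends: "F l = f l + d * a l" "G l = f l + d * b l" "F r = G r"
    using ends by (auto simp: F_def G_def d_def)
  \<comment> \<open>The vertical segment becomes a segment of slope \<open>d\<close>. Its planar
    ends are ordered because \<open>G l - F l\<close> is the square of \<open>d\<close>, whichever
    sign \<open>d\<close> has.\<close>
  have segment: "F l \<le> f l + d * z \<and> f l + d * z \<le> G l" if "z \<in> closed_segment (a l) (b l)" for z
  proof (cases "a l \<le> b l")
    case True
    then show ?thesis using that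
      by (auto simp: FG_ends d_def closed_segment_eq_real_ivl intro!: mult_left_mono)
  next
    case False
    then show ?thesis using that
      by (auto simp: FG_ends d_def closed_segment_eq_real_ivl intro!: mult_left_mono_neg)
  qed

  let ?L = "(\<lambda>t. (t, F t, a t)) ` {l..r} \<union> (\<lambda>t. (t, G t, b t)) ` {l..r} \<union>
    (\<lambda>z. (l, f l + d * z, z)) ` closed_segment (a l) (b l)"
  let ?e1 = "(0, 1, 0) :: real \<times> real \<times> real"
  let ?\<phi> = "\<lambda>x :: real \<times> real \<times> real. (b (fst x) - a (fst x)) * snd (snd x)"
  have "ambient_isotopic ?K ((\<lambda>x. x + ?\<phi> x *\<^sub>R ?e1) ` ?K)"
  proof (rule ambient_isotopic_fibrewise)
    show "continuous_on UNIV ?\<phi>"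
      by (intro continuous_intros continuous_on_compose2[OF cont(4)] continuous_on_compose2[OF cont(2)]) auto
    show "\<exists>r. r + ?\<phi> (x + r *\<^sub>R ?e1) = v" for x v
      by (intro exI[of _ "v - ?\<phi> x"]) simp
  qed (simp_all add: zero_prod_def)
  moreover have "(\<lambda>x. x + ?\<phi> x *\<^sub>R ?e1) ` ?K = ?L"
    by (simp add: image_Un image_image F_def G_def d_def)
  ultimately have shear: "ambient_isotopic ?K ?L" by simp

  have compact: "compact ?L"
    by (intro compact_Un compact_continuous_image continuous_intros compact_segment compact_Icc
        continuous_on_subset[OF contFG(1)] continuous_on_subset[OF contFG(2)]
        continuous_on_subset[OF cont(2)] continuous_on_subset[OF cont(4)]) auto
  have cases: "t \<in> {l..r} \<and> (t = l \<and> z \<in> closed_segment (a l) (b l) \<and> y = f l + d * z \<or>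
      t = r \<and> y = F r \<and> z = a r \<or> l < t \<and> t < r \<and> (y = F t \<and> z = a t \<or> y = G t \<and> z = b t))"
    if "(t, y, z) \<in> ?L" for t y z
    using that \<open>l < r\<close> FG_ends ends by (cases "t = l"; cases "t = r") auto
  \<comment> \<open>In the interior the sheared graphs are strictly separated, and over the right
    end there is a single point. Over the left end either \<open>d\<close> is nonzero, so that
    planar position determines the height, or the segment is a point.\<close>
  have unique: "z = z'" if z: "(t, y, z) \<in> ?L" "(t, y, z') \<in> ?L" for t y z z'
  proof -
    consider "t = l" | "t = r" | "l < t" "t < r" using cases[OF z(1)] by fastforce
    then show ?thesis
    proof cases
      case 1
      then have "z \<in> closed_segment (a l) (b l)" "z' \<in> closed_segment (a l) (b l)" "d * z = d * z'"
        using cases[OF z(1)] cases[OF z(2)] \<open>l < r\<close> by auto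
      then show ?thesis by (cases "d = 0") (auto simp: d_def)
    next
      case 2
      then show ?thesis using cases[OF z(1)] cases[OF z(2)] \<open>l < r\<close> by auto
    next
      case 3
      then show ?thesis using cases[OF z(1)] cases[OF z(2)] FG_less[OF 3] by auto
    qed
  qed
  have "inj_on proj ?L"
  proof (rule inj_onI)
    fix p p' assume pp': "p \<in> ?L" "p' \<in> ?L" "proj p = proj p'"
    obtain t y z where p: "p = (t, y, z)" by (cases p)
    obtain z' where p': "p' = (t, y, z')" using pp'(3) by (cases p') (simp add: proj_def p)
    show "p = p'" using unique[OF pp'(1,2)[unfolded p p']] by (simp add: p p')
  qed
  moreover have contproj: "continuous_on S proj" for S
    unfolding proj_def by (intro continuous_intros)
  \<comment> \<open>By compactness the injective projection is a homeomorphism onto its image. Its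
    inverse makes the height continuous on a closed planar set, and Tietze's theorem extends it to a
    function \<open>k\<close> on the plane.\<close>
  ultimately obtain q where q: "homeomorphism ?L (proj ` ?L) proj q"
    using homeomorphism_compact[OF compact _ refl] by blast
  have "continuous_on (proj ` ?L) (\<lambda>x. snd (snd (q x)))"
    using q by (intro continuous_intros) (auto simp: homeomorphism_def)
  moreover have "closedin (top_of_set UNIV) (proj ` ?L)"
    using compact_continuous_image[OF contproj compact] by (simp add: compact_imp_closed)
  ultimately obtain k where k: "continuous_on UNIV k" "\<And>x. x \<in> proj ` ?L \<Longrightarrow> k x = snd (snd (q x))"
    by (rule Tietze_unbounded) blast
  have k_eq: "k (proj x) = snd (snd x)" if "x \<in> ?L" for x
    using that q k(2)[of "proj x"] by (simp add: homeomorphism_def)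
  let ?e2 = "(0, 0, 1) :: real \<times> real \<times> real"
  let ?\<psi> = "\<lambda>x :: real \<times> real \<times> real. - k (proj x)"
  have flatten: "ambient_isotopic ?L ((\<lambda>x. x + ?\<psi> x *\<^sub>R ?e2) ` ?L)"
  proof (rule ambient_isotopic_fibrewise)
    show "continuous_on UNIV ?\<psi>"
      by (intro continuous_intros continuous_on_compose2[OF k(1) contproj]) auto
    show "\<exists>r. r + ?\<psi> (x + r *\<^sub>R ?e2) = v" for x v
      by (intro exI[of _ "v - ?\<psi> x"]) (simp add: proj_def)
  qed (simp_all add: zero_prod_def proj_def)
  have "(\<lambda>x. x + ?\<psi> x *\<^sub>R ?e2) ` ?L = (\<lambda>x. (fst x, fst (snd x), 0 :: real)) ` ?L"
    by (intro image_cong refl) (auto simp: k_eq simp del: Un_iff)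
  also have "\<dots> = band l r F G"
  proof (intro equalityI subsetI)
    fix x assume "x \<in> (\<lambda>x. (fst x, fst (snd x), 0 :: real)) ` ?L"
    then show "x \<in> band l r F G"
      using FG_le segment \<open>l < r\<close> by (auto simp: band_def)
  next
    fix x assume x: "x \<in> band l r F G"
    obtain t y z where [simp]: "x = (t, y, z)" by (cases x)
    have "\<exists>z'. (t, y, z') \<in> ?L"
    proof -
      have t: "t \<in> {l..r}" using x by (simp add: band_def)
      \<comment> \<open>The left side of the band contributes new points only if \<open>d\<close> is
        nonzero; then the equation of the sloping segment can be solved for the height.\<close>
      consider "y = F t" | "y = G t" | "t = l" "d \<noteq> 0"
        using x FG_ends by (cases "d = 0") (auto simp: band_def)
      then show ?thesis
      proof cases
        case 1
        then have "(t, y, a t) \<in> (\<lambda>t. (t, F t, a t)) ` {l..r}" using t by simp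
        then show ?thesis by blast
      next
        case 2
        then have "(t, y, b t) \<in> (\<lambda>t. (t, G t, b t)) ` {l..r}" using t by simp
        then show ?thesis by blast
      next
        case 3
        then have "(y - f l) / d \<in> closed_segment (a l) (b l)"
          using x FG_ends by (auto simp: band_def closed_segment_eq_real_ivl d_def field_simps)
        moreover have "y = f l + d * ((y - f l) / d)" using 3 by simp
        ultimately show ?thesis using 3 by blast
      qed
    qed
    then obtain z' where "(t, y, z') \<in> ?L" ..
    moreover have "z = 0" using x by (simp add: band_def)
    ultimately show "x \<in> (\<lambda>x. (fst x, fst (snd x), 0 :: real)) ` ?L"
      by (intro image_eqI[of _ _ "(t, y, z')"]) simp_all
  qed
  finally have "ambient_isotopic ?L (band l r F G)" using flatten by simp
  moreover have "ambient_isotopic (band l r F G) std_circle"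
    using contFG \<open>l < r\<close> FG_less FG_le[of l] FG_ends(3) by (intro band_unknotted) auto
  ultimately show ?thesis using ambient_isotopic_trans shear by blast
qed

section \<open>Cut points and polygonal paths\<close>

text \<open>A condition on the point set alone: the vertices may run back and forth along an edge.
  The arguments below therefore concern sets, not parametrizations.\<close>

definition simple_loop :: "(real \<times> real \<times> real) set \<Rightarrow> bool" where
  "simple_loop K \<longleftrightarrow> (\<exists>f g. homeomorphism (sphere (0 :: real \<times> real) 1) K f g)"

text \<open>A circle minus a point is homeomorphic to a line, here the hyperplane orthogonal to
  \<open>(1, 0)\<close>, hence connected. Two closed pieces meeting only in \<open>P\<close> would
  disconnect it.\<close>

lemma simple_loop_no_cut_point:
  assumes loop: "simple_loop K" and K: "K = A \<union> B" and closed: "closed A" "closed B"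
    and meet: "A \<inter> B = {P}"
  shows "A = {P} \<or> B = {P}"
proof -
  obtain f g where fg: "homeomorphism (sphere (0 :: real \<times> real) 1) K f g"
    using loop by (auto simp: simple_loop_def)
  have P: "P \<in> K" using K meet by blast
  have gP: "g P \<in> sphere 0 1" "f (g P) = P"
    using fg P by (auto simp: homeomorphism_def)
  have "(1, 0) \<noteq> (0 :: real \<times> real)" by (simp add: zero_prod_def)
  then have "sphere 0 1 - {g P} homeomorphic {x :: real \<times> real. (1, 0) \<bullet> x = 0}"
    using gP(1) by (intro homeomorphic_punctured_sphere_hyperplane) auto
  then have "connected (sphere 0 1 - {g P})"
    using homeomorphic_connectedness convex_connected convex_hyperplane by blast
  moreover have "f ` (sphere 0 1 - {g P}) = K - {P}"
  proof
    show "f ` (sphere 0 1 - {g P}) \<subseteq> K - {P}"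
      using fg by (auto simp: homeomorphism_def)
    show "K - {P} \<subseteq> f ` (sphere 0 1 - {g P})"
    proof
      fix x assume x: "x \<in> K - {P}"
      then have "g x \<in> sphere 0 1" "f (g x) = x" using fg by (auto simp: homeomorphism_def)
      moreover from this(2) have "g x \<noteq> g P" using gP x by auto
      ultimately show "x \<in> f ` (sphere 0 1 - {g P})" by (metis Diff_iff empty_iff imageI insert_iff)
    qed
  qed
  moreover have "continuous_on (sphere 0 1 - {g P}) f"
    using fg by (auto simp: homeomorphism_def intro: continuous_on_subset)
  ultimately have "connected (K - {P})"
    using connected_continuous_image by metis
  then have "A \<inter> (K - {P}) = {} \<or> B \<inter> (K - {P}) = {}"
    using closed K meet unfolding connected_closed by blast
  then show ?thesis using K meet by blast
qed

lemma simple_loop_compact: "simple_loop K \<Longrightarrow> compact K"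
  unfolding simple_loop_def homeomorphism_def
  by (metis compact_continuous_image compact_sphere)

text \<open>On a vertical line the height is injective. Among the images of three points of the
  circle, the one of middle height would be a cut point.\<close>

lemma simple_loop_not_vertical:
  assumes loop: "simple_loop K"
  shows "\<exists>x\<in>K. proj x \<noteq> c"
proof (rule ccontr)
  assume vertical: "\<not> ?thesis"
  let ?h = "\<lambda>x :: real \<times> real \<times> real. snd (snd x)"
  have inj: "x = y" if "x \<in> K" "y \<in> K" "?h x = ?h y" for x y
  proof -
    have "proj x = proj y" using vertical that by auto
    then show ?thesis using that(3) by (cases x, cases y) (simp add: proj_def)
  qed
  obtain f g where fg: "homeomorphism (sphere (0 :: real \<times> real) 1) K f g"
    using loop by (auto simp: simple_loop_def)
  have mem: "(1, 0) \<in> sphere (0 :: real \<times> real) 1" "(-1, 0) \<in> sphere (0 :: real \<times> real) 1"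
      "(0, 1) \<in> sphere (0 :: real \<times> real) 1"
    by (auto simp: norm_Pair)
  have f_inj: "f x = f y \<longleftrightarrow> x = y" if "x \<in> sphere 0 1" "y \<in> sphere 0 1" for x y
    using fg that unfolding homeomorphism_def by metis
  have fK: "f x \<in> K" if "x \<in> sphere 0 1" for x
    using fg that by (auto simp: homeomorphism_def)
  have "?h (f (1, 0)) \<noteq> ?h (f (-1, 0))" "?h (f (1, 0)) \<noteq> ?h (f (0, 1))" "?h (f (-1, 0)) \<noteq> ?h (f (0, 1))"
    using f_inj[OF mem(1,2)] f_inj[OF mem(1,3)] f_inj[OF mem(2,3)]
      inj[OF fK[OF mem(1)] fK[OF mem(2)]] inj[OF fK[OF mem(1)] fK[OF mem(3)]] inj[OF fK[OF mem(2)] fK[OF mem(3)]]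
    by auto
  then obtain x y z where xyz: "x \<in> K" "y \<in> K" "z \<in> K" "?h x < ?h y" "?h y < ?h z"
    using fK[OF mem(1)] fK[OF mem(2)] fK[OF mem(3)] by (metis linorder_neqE_linordered_idom)
  let ?A = "K \<inter> {q. ?h q \<le> ?h y}" and ?B = "K \<inter> {q. ?h y \<le> ?h q}"
  have "closed ?A" "closed ?B"
    by (intro closed_Int compact_imp_closed[OF simple_loop_compact[OF loop]] closed_Collect_le continuous_intros)+
  moreover have "?A \<inter> ?B = {y}"
  proof (intro equalityI subsetI)
    fix x' assume "x' \<in> ?A \<inter> ?B"
    then have "x' \<in> K" "?h x' = ?h y" by auto
    from inj[OF this(1) xyz(2) this(2)] show "x' \<in> {y}" by simp
  qed (use xyz(2) in auto)
  moreover have "K = ?A \<union> ?B" by auto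
  ultimately have "?A = {y} \<or> ?B = {y}" using simple_loop_no_cut_point[OF loop] by blast
  moreover have "x \<in> ?A" "z \<in> ?B" using xyz by auto
  ultimately show False using xyz by auto
qed

text \<open>The functions are taken continuous on the whole line, so that they can enter directly
  into homeomorphisms of space.\<close>

definition graph_over :: "real \<Rightarrow> real \<Rightarrow> (real \<times> real \<times> real) set \<Rightarrow> bool" where
  "graph_over l r U \<longleftrightarrow> (\<exists>f a. continuous_on UNIV f \<and> continuous_on UNIV a \<and>
     U = (\<lambda>t. (t, f t, a t)) ` {l..r})"

lemma graph_over_segment:
  assumes "fst p < fst q"
  shows "graph_over (fst p) (fst q) (closed_segment p q)"
proof -
  obtain l y z where p: "p = (l, y, z)" by (cases p)
  obtain r y' z' where q: "q = (r, y', z')" by (cases q)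
  have lr: "l < r" using assms by (simp add: p q)
  let ?f = "\<lambda>t. y + (t - l) / (r - l) * (y' - y)" and ?a = "\<lambda>t. z + (t - l) / (r - l) * (z' - z)"
  have "closed_segment p q = (\<lambda>t. (t, ?f t, ?a t)) ` {l..r}"
  proof (intro equalityI subsetI)
    fix x assume "x \<in> closed_segment p q"
    then obtain u where u: "0 \<le> u" "u \<le> 1" "x = (1 - u) *\<^sub>R p + u *\<^sub>R q"
      by (auto simp: in_segment)
    have "l + u * (r - l) \<le> l + 1 * (r - l)"
      using u lr by (intro add_left_mono mult_right_mono) auto
    moreover have "x = (l + u * (r - l), ?f (l + u * (r - l)), ?a (l + u * (r - l)))"
    proof -
      have "(l + u * (r - l) - l) / (r - l) = u" using lr by simp
      then show ?thesis unfolding u(3) p q by (simp add: algebra_simps)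
    qed
    ultimately show "x \<in> (\<lambda>t. (t, ?f t, ?a t)) ` {l..r}"
      using u lr by (intro image_eqI[of _ _ "l + u * (r - l)"]) auto
  next
    fix x assume "x \<in> (\<lambda>t. (t, ?f t, ?a t)) ` {l..r}"
    then obtain t where t: "l \<le> t" "t \<le> r" "x = (t, ?f t, ?a t)" by auto
    define u where "u = (t - l) / (r - l)"
    have "u * (r - l) = t - l" using lr by (simp add: u_def)
    then have "t = (1 - u) * l + u * r" by (simp add: algebra_simps)
    then have "x = (1 - u) *\<^sub>R p + u *\<^sub>R q"
      by (simp add: t(3) p q algebra_simps flip: u_def)
    moreover have "0 \<le> u" "u \<le> 1" using t lr by (auto simp: u_def)
    ultimately show "x \<in> closed_segment p q" by (auto simp: in_segment)
  qed
  moreover have "continuous_on UNIV ?f" "continuous_on UNIV ?a"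
    using lr by (auto intro!: continuous_intros)
  ultimately show ?thesis unfolding graph_over_def by (auto simp: p q)
qed

lemma graph_over_join:
  assumes "graph_over l m U" "graph_over m r V" "q \<in> U" "q \<in> V" "fst q = m" "l \<le> m" "m \<le> r"
  shows "graph_over l r (U \<union> V)"
proof -
  obtain f a where U: "continuous_on UNIV f" "continuous_on UNIV a" "U = (\<lambda>t. (t, f t, a t)) ` {l..m}"
    using assms(1) by (auto simp: graph_over_def)
  obtain g b where V: "continuous_on UNIV g" "continuous_on UNIV b" "V = (\<lambda>t. (t, g t, b t)) ` {m..r}"
    using assms(2) by (auto simp: graph_over_def)
  have agree: "f m = g m" "a m = b m" using assms(3-5) U(3) V(3) by auto
  let ?f = "\<lambda>t. if t \<le> m then f t else g t" and ?a = "\<lambda>t. if t \<le> m then a t else b t"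
  have "continuous_on UNIV ?f" "continuous_on UNIV ?a"
    using agree by (auto intro!: continuous_on_cases_le continuous_intros
        continuous_on_subset[OF U(1)] continuous_on_subset[OF U(2)]
        continuous_on_subset[OF V(1)] continuous_on_subset[OF V(2)])
  moreover have "(\<lambda>t. (t, ?f t, ?a t)) ` {l..r} = U \<union> V"
  proof -
    have "{l..r} = {l..m} \<union> {m..r}" using assms by auto
    moreover have "(\<lambda>t. (t, ?f t, ?a t)) ` {l..m} = U" unfolding U(3) by (rule image_cong) auto
    moreover have "(\<lambda>t. (t, ?f t, ?a t)) ` {m..r} = V"
      unfolding V(3) using agree by (intro image_cong) auto
    ultimately show ?thesis by (simp add: image_Un)
  qed
  ultimately show ?thesis unfolding graph_over_def by metis
qed

definition path_from_to :: "nat \<Rightarrow> nat \<Rightarrow> (nat \<Rightarrow> real \<times> real \<times> real) \<Rightarrow> (real \<times> real \<times> real) set" where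
  "path_from_to i j q = (\<Union>k\<in>{i<..j}. closed_segment (q (k - 1)) (q k))"

lemma polygon_eq_path: "polygon n q = path_from_to 0 n q"
  unfolding polygon_def path_from_to_def by (intro SUP_cong) auto

lemma path_from_to_split: "i \<le> j \<Longrightarrow> j \<le> k \<Longrightarrow> path_from_to i k q = path_from_to i j q \<union> path_from_to j k q"
  unfolding path_from_to_def by (simp flip: UN_Un add: ivl_disj_un_two)

lemma path_from_to_Suc: "i \<le> j \<Longrightarrow> path_from_to i (Suc j) q = path_from_to i j q \<union> closed_segment (q j) (q (Suc j))"
proof -
  assume "i \<le> j"
  then have "{i<..Suc j} = insert (Suc j) {i<..j}" by auto
  then show ?thesis by (auto simp: path_from_to_def)
qed

lemma path_from_to_self [simp]: "path_from_to i i q = {}"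
  by (simp add: path_from_to_def)

lemma compact_path_from_to: "compact (path_from_to i j q)"
  unfolding path_from_to_def by (intro compact_UN) auto

lemma endpoints_in_path:
  assumes "i < j"
  shows "q i \<in> path_from_to i j q" "q j \<in> path_from_to i j q"
  using assms unfolding path_from_to_def by (force intro: bexI[of _ "Suc i"], force intro: bexI[of _ j])

lemma graph_over_increasing_path:
  assumes "i < j" "\<And>k. i < k \<Longrightarrow> k \<le> j \<Longrightarrow> fst (q (k - 1)) < fst (q k)"
  shows "fst (q i) < fst (q j) \<and> graph_over (fst (q i)) (fst (q j)) (path_from_to i j q)"
  using assms
proof (induction j)
  case (Suc j)
  have step: "fst (q j) < fst (q (Suc j))" using Suc.prems(2)[of "Suc j"] Suc.prems(1) by simp
  show ?case
  proof (cases "i = j")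
    case True
    then show ?thesis using step graph_over_segment[OF step] by (simp add: path_from_to_Suc)
  next
    case False
    then have ij: "i < j" using Suc.prems(1) by simp
    have IH: "fst (q i) < fst (q j)" "graph_over (fst (q i)) (fst (q j)) (path_from_to i j q)"
      using Suc.IH[OF ij] Suc.prems(2) by auto
    show ?thesis
      using IH step graph_over_join[OF IH(2) graph_over_segment[OF step] endpoints_in_path(2)[OF ij]] ij
      by (simp add: path_from_to_Suc)
  qed
qed simp

lemma graph_over_decreasing_path:
  assumes "i < j" "\<And>k. i < k \<Longrightarrow> k \<le> j \<Longrightarrow> fst (q k) < fst (q (k - 1))"
  shows "fst (q j) < fst (q i) \<and> graph_over (fst (q j)) (fst (q i)) (path_from_to i j q)"
  using assms
proof (induction j)
  case (Suc j)
  have step: "fst (q (Suc j)) < fst (q j)" using Suc.prems(2)[of "Suc j"] Suc.prems(1) by simp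
  note segment = graph_over_segment[OF step, unfolded closed_segment_commute[of "q (Suc j)"]]
  show ?case
  proof (cases "i = j")
    case True
    then show ?thesis using step segment by (simp add: path_from_to_Suc)
  next
    case False
    then have ij: "i < j" using Suc.prems(1) by simp
    have IH: "fst (q j) < fst (q i)" "graph_over (fst (q j)) (fst (q i)) (path_from_to i j q)"
      using Suc.IH[OF ij] Suc.prems(2) by auto
    show ?thesis
      using IH step graph_over_join[OF segment IH(2) _ endpoints_in_path(2)[OF ij]] ij
      by (simp add: path_from_to_Suc Un_commute)
  qed
qed simp

text \<open>The starting vertex is inserted because the path is empty when
  \<open>i = j\<close>.\<close>

lemma connected_path:
  assumes "i \<le> j"
  shows "connected (insert (q i) (path_from_to i j q)) \<and> q j \<in> insert (q i) (path_from_to i j q)"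
  using assms
proof (induction j rule: dec_induct)
  case (step j)
  have "connected (insert (q i) (path_from_to i j q) \<union> closed_segment (q j) (q (Suc j)))"
    using step by (intro connected_Un) auto
  then show ?case using step(1) by (simp add: path_from_to_Suc)
qed simp

lemma path_subset_convex:
  assumes "convex S" "\<And>k. i \<le> k \<Longrightarrow> k \<le> j \<Longrightarrow> q k \<in> S"
  shows "path_from_to i j q \<subseteq> S"
  unfolding path_from_to_def using assms by (intro UN_least closed_segment_subset) auto

section \<open>Bimonotone loops\<close>

text \<open>The sign \<open>s\<close> covers both directions in which \<open>W\<close> could stick out: the point of \<open>C\<close> at
  extreme height would be a cut point.\<close>

lemma vertical_part_within:
  assumes loop: "simple_loop K" and K: "K = C \<union> W" and closed: "closed C" "closed W"
    and W: "\<And>x. x \<in> W \<Longrightarrow> proj x = c"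
    and heights: "\<And>x. x \<in> C \<Longrightarrow> proj x = c \<Longrightarrow> s * snd (snd x) \<le> s * m"
    and P: "P \<in> C" "proj P = c" "snd (snd P) = m" and "s \<noteq> 0" and x: "x \<in> W"
    and other: "y \<in> C" "proj y \<noteq> c"
  shows "s * snd (snd x) \<le> s * m"
proof (rule ccontr)
  assume *: "\<not> ?thesis"
  let ?h = "\<lambda>x :: real \<times> real \<times> real. snd (snd x)"
  \<comment> \<open>\<open>?A\<close> is the part of \<open>W\<close> beyond the extreme height and
    \<open>?B\<close> is everything else. \<open>P\<close> is inserted because it is only known to
    lie in \<open>C\<close>, and the two sets have to share it.\<close>
  let ?A = "insert P (W \<inter> {x. s * m \<le> s * ?h x})" and ?B = "C \<union> (W \<inter> {x. s * ?h x \<le> s * m})"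
  have "K = ?A \<union> ?B" using K P(1) by auto
  moreover have "closed ?A" "closed ?B"
    by (intro closed_Un closed_insert closed_Int closed closed_Collect_le continuous_intros)+
  moreover have "?A \<inter> ?B = {P}"
  proof (intro equalityI subsetI)
    fix x assume x: "x \<in> ?A \<inter> ?B"
    show "x \<in> {P}"
    proof (cases "x = P")
      case False
      then have "x \<in> W" "s * m \<le> s * ?h x" using x by auto
      moreover from this(1) have "proj x = c" by (rule W)
      ultimately have "s * ?h x = s * m" using x heights[of x] by (intro antisym) auto
      then have "?h x = ?h P" using \<open>s \<noteq> 0\<close> P by simp
      then show ?thesis using \<open>proj x = c\<close> P(2) by (cases x, cases P) (auto simp: proj_def)
    qed simp
  qed (use P in auto)
  ultimately have "?A = {P} \<or> ?B = {P}" by (rule simple_loop_no_cut_point[OF loop])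
  moreover have "x \<in> ?A" "x \<noteq> P" using x * P by auto
  moreover have "y \<in> ?B" "y \<noteq> P" using other P by auto
  ultimately show False by blast
qed

text \<open>Vertex \<open>i\<close> is the right end, and from \<open>j\<close> on the loop is
  vertical. The level of \<open>q 0\<close> separates the outgoing graph below from the returning
  graph above. Cut points exclude interior contacts and confine the vertical part, which is thus
  exactly the segment needed for \<open>two_graphs_unknotted\<close>.\<close>

lemma bimonotone_unknotted:
  assumes loop: "simple_loop (polygon n q)" and ij: "0 < i" "i < j" "j \<le> n" and closed: "q n = q 0"
    and inc: "\<And>k. 0 < k \<Longrightarrow> k \<le> i \<Longrightarrow> fst (q (k - 1)) < fst (q k)"
    and dec: "\<And>k. i < k \<Longrightarrow> k \<le> j \<Longrightarrow> fst (q k) < fst (q (k - 1))"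
    and vertical: "\<And>k. j \<le> k \<Longrightarrow> k \<le> n \<Longrightarrow> proj (q k) = proj (q n)"
    and lower: "\<And>k. k \<le> i \<Longrightarrow> fst (snd (q k)) \<le> fst (snd (q 0))"
    and upper: "\<And>k. i \<le> k \<Longrightarrow> k \<le> j \<Longrightarrow> fst (snd (q 0)) \<le> fst (snd (q k))"
  shows "ambient_isotopic (polygon n q) std_circle"
proof -
  define U where "U = path_from_to 0 i q"
  define V where "V = path_from_to i j q"
  \<comment> \<open>Inserting \<open>q j\<close> keeps \<open>W\<close> nonempty when
    \<open>j = n\<close>, that is, when there are no vertical edges.\<close>
  define W where "W = insert (q j) (path_from_to j n q)"
  define l where "l = fst (q 0)"
  define r where "r = fst (q i)"
  define y0 where "y0 = fst (snd (q 0))"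
  have projq: "proj (q j) = proj (q 0)" using vertical[of j] ij closed by simp
  have qj: "fst (q j) = l" "fst (snd (q j)) = y0"
    using projq by (auto simp: proj_def l_def y0_def)
  have lr: "l < r" and "graph_over l r U"
    using graph_over_increasing_path[of 0 i q, OF ij(1) inc] by (auto simp: U_def l_def r_def)
  then obtain f a where U: "continuous_on UNIV f" "continuous_on UNIV a" "U = (\<lambda>t. (t, f t, a t)) ` {l..r}"
    by (auto simp: graph_over_def)
  have "graph_over l r V"
    using graph_over_decreasing_path[of i j q, OF ij(2) dec] qj by (auto simp: V_def r_def)
  then obtain g b where V: "continuous_on UNIV g" "continuous_on UNIV b" "V = (\<lambda>t. (t, g t, b t)) ` {l..r}"
    by (auto simp: graph_over_def)
  have K: "polygon n q = U \<union> V \<union> W"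
    using ij endpoints_in_path(2)[OF ij(2), of q]
    by (auto simp: polygon_eq_path U_def V_def W_def path_from_to_split[of 0 i n] path_from_to_split[of i j n])
  have W_proj: "proj x = (l, y0)" if "x \<in> W" for x
  proof -
    have "convex (proj -` {(l, y0)})"
      by (intro convex_linear_vimage) (auto simp: proj_def intro!: linearI)
    then have "path_from_to j n q \<subseteq> proj -` {(l, y0)}"
      using vertical ij by (intro path_subset_convex) (auto simp: closed proj_def l_def y0_def)
    then show ?thesis using that qj by (auto simp: W_def proj_def)
  qed
  have compact: "compact U" "compact V" "compact W"
    by (auto simp: U_def V_def W_def intro!: compact_insert compact_path_from_to)
  have q0: "q 0 = (l, f l, a l)" "y0 = f l"
  proof -
    have "q 0 \<in> U" unfolding U_def by (rule endpoints_in_path(1)[OF ij(1)])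
    then show "q 0 = (l, f l, a l)" by (auto simp: U(3) l_def)
    then show "y0 = f l" by (simp add: y0_def)
  qed
  have qj': "q j = (l, g l, b l)" "y0 = g l"
  proof -
    have "q j \<in> V" unfolding V_def by (rule endpoints_in_path(2)[OF ij(2)])
    then show "q j = (l, g l, b l)" using qj(1) by (auto simp: V(3))
    then show "y0 = g l" using qj(2) by simp
  qed
  have right: "f r = g r" "a r = b r"
  proof -
    have "q i \<in> U" "q i \<in> V"
      unfolding U_def V_def by (rule endpoints_in_path(2)[OF ij(1)], rule endpoints_in_path(1)[OF ij(2)])
    then have "q i = (r, f r, a r)" "q i = (r, g r, b r)" by (auto simp: U(3) V(3) r_def)
    then show "f r = g r" "a r = b r" by simp_all
  qed
  have f_le: "f t \<le> y0" and g_ge: "y0 \<le> g t" if "t \<in> {l..r}" for t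
  proof -
    have lin: "linear (\<lambda>x :: real \<times> real \<times> real. fst (snd x))" by (auto intro!: linearI)
    have "U \<subseteq> (\<lambda>x. fst (snd x)) -` {..y0}"
      unfolding U_def using lower
      by (intro path_subset_convex convex_linear_vimage lin) (auto simp: y0_def)
    moreover have "(t, f t, a t) \<in> U" using that by (simp add: U(3))
    ultimately show "f t \<le> y0" by auto
    have "V \<subseteq> (\<lambda>x. fst (snd x)) -` {y0..}"
      unfolding V_def using upper
      by (intro path_subset_convex convex_linear_vimage lin) (auto simp: y0_def)
    moreover have "(t, g t, b t) \<in> V" using that by (simp add: V(3))
    ultimately show "y0 \<le> g t" by auto
  qed
  \<comment> \<open>At a contact the loop would meet the plane of first coordinate \<open>t\<close>
    in a single point, with \<open>q 0\<close> strictly on one side and the right end strictly on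
    the other: a cut point.\<close>
  have disjoint: "a t \<noteq> b t" if t: "l < t" "t < r" "f t = g t" for t
  proof
    assume ab: "a t = b t"
    let ?A = "polygon n q \<inter> {x. fst x \<le> t}" and ?B = "polygon n q \<inter> {x. t \<le> fst x}"
    have "polygon n q = ?A \<union> ?B" by auto
    moreover have "closed ?A" "closed ?B"
      by (intro closed_Int compact_imp_closed[OF simple_loop_compact[OF loop]] closed_Collect_le continuous_intros)+
    moreover have "?A \<inter> ?B = {(t, f t, a t)}"
    proof (intro equalityI subsetI)
      fix x assume "x \<in> ?A \<inter> ?B"
      then have x: "x \<in> U \<union> V \<union> W" "fst x = t" by (auto simp: K)
      have "x \<notin> W" using W_proj[of x] x(2) t(1) by (auto simp: proj_def)
      then show "x \<in> {(t, f t, a t)}" using x ab t(3) by (auto simp: U(3) V(3))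
    qed (use t in \<open>auto simp: K U(3)\<close>)
    ultimately have "?A = {(t, f t, a t)} \<or> ?B = {(t, f t, a t)}"
      by (rule simple_loop_no_cut_point[OF loop])
    then show False
    proof
      assume "?A = {(t, f t, a t)}"
      moreover have "q 0 \<in> ?A" "q 0 \<noteq> (t, f t, a t)" using lr t q0 by (auto simp: K U(3))
      ultimately show False by simp
    next
      assume "?B = {(t, f t, a t)}"
      moreover have "(r, f r, a r) \<in> ?B" "(r, f r, a r) \<noteq> (t, f t, a t)" using lr t by (auto simp: K U(3))
      ultimately show False by simp
    qed
  qed
  have heights: "snd (snd x) \<in> {a l, b l}" if "x \<in> U \<union> V" "proj x = (l, y0)" for x
    using that by (auto simp: U(3) V(3) proj_def)
  have mem: "(t, f t, a t) \<in> U \<union> V" "(t, g t, b t) \<in> U \<union> V" if "l \<le> t" "t \<le> r" for t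
    using that unfolding U(3) V(3) by simp_all
  have ends_in: "(l, y0, a l) \<in> U \<union> V" "(l, y0, b l) \<in> U \<union> V" "(r, f r, a r) \<in> U \<union> V"
    using mem[of l] mem[of r] lr q0(2) qj'(2) by simp_all
  \<comment> \<open>Here \<open>m\<close> is an extreme one of the heights \<open>a l\<close> and
    \<open>b l\<close>. The sign \<open>s = 1\<close> yields the upper bound and
    \<open>s = -1\<close> the lower one.\<close>
  have W_bound: "s * snd (snd x) \<le> s * m"
    if "x \<in> W" "s \<noteq> 0" "m = a l \<or> m = b l" "s * a l \<le> s * m" "s * b l \<le> s * m" for x s m
  proof (rule vertical_part_within[OF loop K _ _ W_proj])
    show "closed (U \<union> V)" "closed W"
      using compact by (simp_all add: compact_imp_closed closed_Un)
    show "s * snd (snd x) \<le> s * m" if "x \<in> U \<union> V" "proj x = (l, y0)" for x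
      using heights[OF that] \<open>s * a l \<le> s * m\<close> \<open>s * b l \<le> s * m\<close> by auto
    show "(l, y0, m) \<in> U \<union> V" using ends_in that(3) by auto
    show "(r, f r, a r) \<in> U \<union> V" by (rule ends_in)
  qed (use that lr in \<open>auto simp: proj_def\<close>)
  have le_max: "snd (snd x) \<le> max (a l) (b l)" if "x \<in> W" for x
    using W_bound[OF that, of 1 "max (a l) (b l)"] by (simp add: max_def)
  have ge_min: "min (a l) (b l) \<le> snd (snd x)" if "x \<in> W" for x
    using W_bound[OF that, of "-1" "min (a l) (b l)"] by (simp add: min_def)
  have "W = (\<lambda>z. (l, f l, z)) ` closed_segment (a l) (b l)"
  proof (intro equalityI subsetI)
    fix x assume x: "x \<in> W"
    have "snd (snd x) \<in> closed_segment (a l) (b l)"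
      using le_max[OF x] ge_min[OF x] by (auto simp: closed_segment_eq_real_ivl)
    moreover have "x = (l, f l, snd (snd x))" using W_proj[OF x] q0(2) by (cases x) (simp add: proj_def)
    ultimately show "x \<in> (\<lambda>z. (l, f l, z)) ` closed_segment (a l) (b l)" by blast
  next
    fix x assume "x \<in> (\<lambda>z. (l, f l, z)) ` closed_segment (a l) (b l)"
    then obtain z where z: "x = (l, f l, z)" "z \<in> closed_segment (a l) (b l)" by blast
    \<comment> \<open>For the converse, \<open>W\<close> is connected and contains
      \<open>q j\<close> and \<open>q n = q 0\<close>, whose heights are \<open>b l\<close> and
      \<open>a l\<close>. It attains all heights in between.\<close>
    let ?H = "(\<lambda>x. snd (snd x)) ` W"
    have conn: "connected W" "q n \<in> W"
      using connected_path[OF ij(3), of q] by (auto simp: W_def)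
    then have "connected ?H" by (intro connected_continuous_image continuous_intros)
    moreover have "a l \<in> ?H" using conn(2) closed q0 by (force intro: image_eqI[of _ _ "q n"])
    moreover have "b l \<in> ?H" using qj' by (force simp: W_def)
    ultimately have "closed_segment (a l) (b l) \<subseteq> ?H"
      by (simp add: connected_convex_1 closed_segment_subset is_interval_connected_1 is_interval_convex_1)
    then obtain x' where "x' \<in> W" "snd (snd x') = z" using z(2) by auto
    then show "x \<in> W" using W_proj[of x'] q0(2) z(1) by (cases x') (simp add: proj_def)
  qed
  moreover have "ambient_isotopic (U \<union> V \<union> (\<lambda>z. (l, f l, z)) ` closed_segment (a l) (b l)) std_circle"
    unfolding U(3) V(3)
  proof (rule two_graphs_unknotted)
    show "f t \<le> g t" if "l \<le> t" "t \<le> r" for t using f_le[of t] g_ge[of t] that by simp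
  qed (use U V lr disjoint right q0 qj' in auto)
  ultimately show ?thesis unfolding K by simp
qed

section \<open>The ordering\<close>

lemma chain_le:
  fixes h :: "nat \<Rightarrow> real"
  assumes "i \<le> j" "\<And>k. i < k \<Longrightarrow> k \<le> j \<Longrightarrow> h (k - 1) \<le> h k"
  shows "h i \<le> h j"
  using assms
proof (induction j rule: dec_induct)
  case (step j)
  have "h i \<le> h j" using step by auto
  also have "h j \<le> h (Suc j)" using step.prems[of "Suc j"] step.hyps by simp
  finally show ?case .
qed simp

lemma initial_segment_threshold:
  fixes P :: "nat \<Rightarrow> bool"
  assumes "\<And>a b. 1 \<le> a \<Longrightarrow> a \<le> b \<Longrightarrow> b \<le> n \<Longrightarrow> P b \<Longrightarrow> P a"
  shows "\<exists>N\<le>n. \<forall>k\<in>{1..n}. P k \<longleftrightarrow> k \<le> N"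
  using assms
proof (induction n)
  case (Suc n)
  show ?case
  proof (cases "P (Suc n)")
    case True
    then have "\<forall>k\<in>{1..Suc n}. P k \<longleftrightarrow> k \<le> Suc n" using Suc.prems by auto
    then show ?thesis by blast
  next
    case False
    have "\<exists>N\<le>n. \<forall>k\<in>{1..n}. P k \<longleftrightarrow> k \<le> N"
      by (rule Suc.IH, rule Suc.prems) auto
    then obtain N where N: "N \<le> n" "\<And>k. k \<in> {1..n} \<Longrightarrow> P k \<longleftrightarrow> k \<le> N" by blast
    have "P k \<longleftrightarrow> k \<le> N" if "k \<in> {1..Suc n}" for k
      using that N False by (cases "k = Suc n") auto
    then show ?thesis using N(1) by (intro exI[of _ N]) auto
  qed
qed simp

lemma exists_sorting_permutation:
  fixes c :: "nat \<Rightarrow> nat"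
  shows "\<exists>\<sigma>. \<sigma> permutes {1..n} \<and> (\<forall>a b. 1 \<le> a \<longrightarrow> a \<le> b \<longrightarrow> b \<le> n \<longrightarrow> c (\<sigma> a) \<le> c (\<sigma> b))"
proof -
  define xs where "xs = sort_key c [1..<Suc n]"
  define \<sigma> where "\<sigma> k = (if k \<in> {1..n} then xs ! (k - 1) else k)" for k
  have xs: "length xs = n" "distinct xs" "set xs = {1..n}" "sorted (map c xs)"
    by (auto simp: xs_def)
  have "bij_betw (\<lambda>i. xs ! i) {..<n} {1..n}"
    using xs bij_betw_nth[of xs "{..<n}" "{1..n}"] by simp
  moreover have "bij_betw (\<lambda>k. k - 1) {1..n} {..<n}"
    by (rule bij_betw_byWitness[of _ Suc]) auto
  ultimately have "bij_betw ((\<lambda>i. xs ! i) \<circ> (\<lambda>k. k - 1)) {1..n} {1..n}"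
    by (rule bij_betw_trans[rotated])
  then have "bij_betw \<sigma> {1..n} {1..n}"
    by (rule bij_betw_cong[THEN iffD1, rotated]) (simp add: \<sigma>_def)
  then have "\<sigma> permutes {1..n}" by (rule bij_imp_permutes) (auto simp: \<sigma>_def)
  moreover have "c (\<sigma> a) \<le> c (\<sigma> b)" if "1 \<le> a" "a \<le> b" "b \<le> n" for a b
    using sorted_nth_mono[OF xs(4), of "a - 1" "b - 1"] that xs(1) by (auto simp: \<sigma>_def)
  ultimately show ?thesis by blast
qed

text \<open>Quadrants numbered counterclockwise from the lower right one, followed by
  \<open>t = 0\<close>. For a generic slope the last class contains only zero vectors.\<close>

definition direction_class :: "real \<Rightarrow> real \<Rightarrow> nat" where
  "direction_class t s =
     (if 0 < t then if s \<le> 0 then 1 else 2 else if t < 0 then if 0 \<le> s then 3 else 4 else 5)"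

text \<open>While the first coordinate grows, the second falls and then rises, returning to its
  initial level by \<open>balance\<close>. While the first coordinate decreases, the second rises
  and then falls, back to the initial level because all later steps are zero. This is the shape
  required by \<open>bimonotone_unknotted\<close>.\<close>

lemma sorted_directions_unknotted:
  fixes t s :: "nat \<Rightarrow> real"
  assumes loop: "simple_loop (polygon n q)" and closed: "q n = q 0"
    and t: "\<And>k. 1 \<le> k \<Longrightarrow> k \<le> n \<Longrightarrow> fst (q k) = fst (q (k - 1)) + t k"
    and s: "\<And>k. 1 \<le> k \<Longrightarrow> k \<le> n \<Longrightarrow> fst (snd (q k)) = fst (snd (q (k - 1))) + s k"
    and sorted: "\<And>a b. 1 \<le> a \<Longrightarrow> a \<le> b \<Longrightarrow> b \<le> n \<Longrightarrow> direction_class (t a) (s a) \<le> direction_class (t b) (s b)"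
    and zero: "\<And>k. 1 \<le> k \<Longrightarrow> k \<le> n \<Longrightarrow> t k = 0 \<Longrightarrow> s k = 0"
    and balance: "(\<Sum>k\<in>{k \<in> {1..n}. 0 < t k}. s k) = 0"
  shows "ambient_isotopic (polygon n q) std_circle"
proof -
  let ?c = "\<lambda>k. direction_class (t k) (s k)"
  let ?y = "\<lambda>k. fst (snd (q k))"
  have "\<exists>N\<le>n. \<forall>k\<in>{1..n}. ?c k \<le> c \<longleftrightarrow> k \<le> N" for c
    by (rule initial_segment_threshold) (use sorted order_trans in blast)
  then obtain N where N_le: "\<And>c. N c \<le> n"
    and N: "\<And>c k. 1 \<le> k \<Longrightarrow> k \<le> n \<Longrightarrow> ?c k \<le> c \<longleftrightarrow> k \<le> N c"
    by (metis atLeastAtMost_iff)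
  have N_mono: "N c \<le> N d" if "c \<le> d" for c d
    using N[of "N c" c] N[of "N c" d] N_le[of c] that by (cases "N c = 0") auto
  \<comment> \<open>\<open>N c\<close> counts the steps of class at most \<open>c\<close>; hence
    \<open>i\<close> counts those with \<open>t > 0\<close>, and \<open>j\<close> those with
    \<open>t\<close> nonzero.\<close>
  define i where "i = N 2"
  define j where "j = N 4"
  have ij: "i \<le> j" "j \<le> n" unfolding i_def j_def using N_mono N_le by auto
  have pos: "0 < t k \<longleftrightarrow> k \<le> i" if "1 \<le> k" "k \<le> n" for k
    using N[OF that, of 2] by (auto simp: i_def direction_class_def split: if_splits)
  have nonzero: "t k \<noteq> 0 \<longleftrightarrow> k \<le> j" if "1 \<le> k" "k \<le> n" for k
    using N[OF that, of 4] by (auto simp: j_def direction_class_def split: if_splits)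
  have s_1: "s k \<le> 0" if "1 \<le> k" "k \<le> N 1" for k
    using N[of k 1] N_le[of 1] that by (auto simp: direction_class_def split: if_splits)
  have s_2: "0 \<le> s k" if "N 1 < k" "k \<le> N 2" for k
    using N[of k 1] N[of k 2] N_le[of 2] that by (auto simp: direction_class_def split: if_splits)
  have s_3: "0 \<le> s k" if "N 2 < k" "k \<le> N 3" for k
    using N[of k 2] N[of k 3] N_le[of 3] that by (auto simp: direction_class_def split: if_splits)
  have s_4: "s k \<le> 0" if "N 3 < k" "k \<le> N 4" for k
    using N[of k 3] N[of k 4] N_le[of 4] that by (auto simp: direction_class_def split: if_splits)
  have inc: "fst (q (k - 1)) < fst (q k)" if "0 < k" "k \<le> i" for k
    using t[of k] pos[of k] that ij by simp
  have dec: "fst (q k) < fst (q (k - 1))" if "i < k" "k \<le> j" for k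
    using t[of k] pos[of k] nonzero[of k] that ij by simp
  have vertical: "proj (q k) = proj (q n)" if "j \<le> k" "k \<le> n" for k
    using that(2,1)
  proof (induction k rule: inc_induct)
    case (step k)
    have "t (Suc k) = 0" using nonzero[of "Suc k"] step by auto
    moreover from this have "s (Suc k) = 0" using zero[of "Suc k"] step by auto
    ultimately have "proj (q (Suc k)) = proj (q k)"
      using t[of "Suc k"] s[of "Suc k"] step by (simp add: proj_def)
    then show ?case using step by simp
  qed simp
  have proj_j: "proj (q j) = proj (q 0)" using vertical[of j] ij closed by simp
  have y_sum: "?y k = ?y 0 + (\<Sum>m\<in>{1..k}. s m)" if "k \<le> n" for k
    using that by (induction k) (simp_all add: s)
  have "{1..i} = {k \<in> {1..n}. 0 < t k}"
    using pos ij by (intro set_eqI iffI) auto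
  then have y_i: "?y i = ?y 0" using y_sum[of i] balance ij by simp
  have y_j: "?y j = ?y 0" using proj_j by (simp add: proj_def)
  have lower: "?y k \<le> ?y 0" if "k \<le> i" for k
  proof (cases "k \<le> N 1")
    case True
    have "- ?y 0 \<le> - ?y k"
      by (rule chain_le[of 0 k "\<lambda>k. - ?y k"]) (use True s s_1 N_le[of 1] in auto)
    then show ?thesis by simp
  next
    case False
    have "?y k \<le> ?y i"
      by (rule chain_le[of k i ?y]) (use False that s s_2 ij in \<open>auto simp: i_def\<close>)
    then show ?thesis using y_i by simp
  qed
  have upper: "?y 0 \<le> ?y k" if "i \<le> k" "k \<le> j" for k
  proof (cases "k \<le> N 3")
    case True
    have "?y i \<le> ?y k"
      by (rule chain_le[of i k ?y]) (use True that s s_3 N_le[of 3] in \<open>auto simp: i_def\<close>)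
    then show ?thesis using y_i by simp
  next
    case False
    have "- ?y k \<le> - ?y j"
      by (rule chain_le[of k j "\<lambda>k. - ?y k"]) (use False that s s_4 ij in \<open>auto simp: j_def\<close>)
    then show ?thesis using y_j by simp
  qed
  have fst_j: "fst (q j) = fst (q 0)" using proj_j by (simp add: proj_def)
  \<comment> \<open>Without steps to the right, either all steps are zero and the loop is vertical,
    or the first coordinate strictly decreases and the path cannot return to its start.\<close>
  have "0 < i"
  proof (rule ccontr)
    assume "\<not> 0 < i"
    then have i: "i = 0" by simp
    show False
    proof (cases "j = 0")
      case True
      have "convex (proj -` {proj (q n)})"
        by (intro convex_linear_vimage) (auto simp: proj_def intro!: linearI)
      then have "polygon n q \<subseteq> proj -` {proj (q n)}"
        unfolding polygon_eq_path
      proof (rule path_subset_convex)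
        show "q k \<in> proj -` {proj (q n)}" if "k \<le> n" for k
          using vertical[of k] True that by simp
      qed
      then show False using simple_loop_not_vertical[OF loop, of "proj (q n)"] by auto
    next
      case False
      then show False using graph_over_decreasing_path[of 0 j q] dec i fst_j by auto
    qed
  qed
  moreover have "i < j"
    using graph_over_increasing_path[of 0 i q, OF \<open>0 < i\<close> inc] fst_j ij(1) by (cases "i = j") auto
  ultimately show ?thesis
    using loop ij closed inc dec vertical lower upper by (intro bimonotone_unknotted[of n q i j])
qed

section \<open>Normalizing the plane by shears\<close>

definition shear :: "real \<Rightarrow> real \<Rightarrow> real \<times> real \<times> real \<Rightarrow> real \<times> real \<times> real" where
  "shear c \<mu> q = (fst q + c * fst (snd q), fst (snd q) - \<mu> * (fst q + c * fst (snd q)), snd (snd q))"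

lemma linear_shear: "linear (shear c \<mu>)"
  by (intro linearI) (auto simp: shear_def algebra_simps)

lemma inj_shear: "inj (shear c \<mu>)"
  by (intro injI) (auto simp: shear_def prod_eq_iff)

text \<open>The coordinates \<open>t = x + c * y\<close> and \<open>s = y - \<mu> * t\<close> arise
  from two successive elementary shears, each of which is a fibrewise isotopy.\<close>

lemma ambient_isotopic_shear: "ambient_isotopic K (shear c \<mu> ` K)"
proof -
  let ?\<phi> = "\<lambda>x :: real \<times> real \<times> real. c * fst (snd x)"
  let ?\<psi> = "\<lambda>x :: real \<times> real \<times> real. - \<mu> * fst x"
  let ?e1 = "(1, 0, 0) :: real \<times> real \<times> real"
  let ?e2 = "(0, 1, 0) :: real \<times> real \<times> real"
  have "ambient_isotopic K ((\<lambda>x. x + ?\<phi> x *\<^sub>R ?e1) ` K)"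
  proof (rule ambient_isotopic_fibrewise)
    show "\<exists>r. r + ?\<phi> (x + r *\<^sub>R ?e1) = v" for x v by (intro exI[of _ "v - ?\<phi> x"]) simp
    show "continuous_on UNIV ?\<phi>" by (intro continuous_intros)
  qed (simp_all add: zero_prod_def)
  moreover have "ambient_isotopic L ((\<lambda>x. x + ?\<psi> x *\<^sub>R ?e2) ` L)" for L
  proof (rule ambient_isotopic_fibrewise)
    show "\<exists>r. r + ?\<psi> (x + r *\<^sub>R ?e2) = v" for x v by (intro exI[of _ "v - ?\<psi> x"]) simp
    show "continuous_on UNIV ?\<psi>" by (intro continuous_intros)
  qed (simp_all add: zero_prod_def)
  ultimately have "ambient_isotopic K ((\<lambda>x. x + ?\<psi> x *\<^sub>R ?e2) ` (\<lambda>x. x + ?\<phi> x *\<^sub>R ?e1) ` K)"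
    using ambient_isotopic_trans by blast
  moreover have "(\<lambda>x. x + ?\<psi> x *\<^sub>R ?e2) ` (\<lambda>x. x + ?\<phi> x *\<^sub>R ?e1) ` K = shear c \<mu> ` K"
    unfolding image_image by (intro image_cong refl) (simp add: shear_def prod_eq_iff)
  ultimately show ?thesis by simp
qed

lemma simple_loop_linear_image:
  assumes "simple_loop K" "linear A" "inj A"
  shows "simple_loop (A ` K)"
proof -
  obtain f g where fg: "homeomorphism (sphere (0 :: real \<times> real) 1) K f g"
    using assms(1) by (auto simp: simple_loop_def)
  obtain h where "homeomorphism K (A ` K) A h"
    using homeomorphism_compact[OF simple_loop_compact[OF assms(1)] _ refl, of A]
      linear_continuous_on[OF assms(2)[unfolded linear_conv_bounded_linear]] assms(3)
    by (auto intro: inj_on_subset)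
  from homeomorphism_compose[OF fg this] show ?thesis
    unfolding simple_loop_def by blast
qed

lemma polygon_linear_image:
  assumes "linear A"
  shows "polygon n (A \<circ> p) = A ` polygon n p"
  unfolding polygon_def by (simp add: closed_segment_linear_image[OF assms] image_UN)

text \<open>Each vector with \<open>y k\<close> nonzero forbids one value of \<open>c\<close>. For
  \<open>y k = 0\<close> the default quotient merely forbids 0, so the forbidden set is still
  finite.\<close>

lemma exists_generic_slope:
  fixes x y :: "nat \<Rightarrow> real"
  shows "\<exists>c. \<forall>k\<in>{1..n}. x k + c * y k = 0 \<longrightarrow> y k = 0"
proof -
  obtain c where c: "c \<notin> (\<lambda>k. - x k / y k) ` {1..n}"
    using ex_new_if_finite[OF infinite_UNIV_char_0[where 'a = real], of "(\<lambda>k. - x k / y k) ` {1..n}"] by auto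
  have "y k = 0" if "k \<in> {1..n}" "x k + c * y k = 0" for k
  proof (rule ccontr)
    assume "y k \<noteq> 0"
    then have "c = - x k / y k" using that(2) by (simp add: field_simps)
    then show False using c that(1) by blast
  qed
  then show ?thesis by blast
qed

theorem theorem2p4:
  fixes n :: nat and w :: "nat \<Rightarrow> real \<times> real \<times> real"
  assumes "(\<Sum>k=1..n. proj (w k)) = 0"
  shows "\<exists>\<sigma>. \<sigma> permutes {1..n} \<and>
           (\<forall>p. realization n (\<lambda>k. proj (w k)) \<sigma> p \<and> embedded n p \<longrightarrow> is_unknot (polygon n p))"
proof -
  define x where "x k = fst (w k)" for k
  define y where "y k = fst (snd (w k))" for k
  obtain c where c: "\<And>k. k \<in> {1..n} \<Longrightarrow> x k + c * y k = 0 \<Longrightarrow> y k = 0"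
    using exists_generic_slope[of n x y] by blast
  define t where "t k = x k + c * y k" for k
  define P where "P = {k \<in> {1..n}. 0 < t k}"
  \<comment> \<open>This \<open>\<mu>\<close> solves
    \<open>(\<Sum>k\<in>P. y k - \<mu> * t k) = 0\<close>; the denominator is positive unless
    \<open>P\<close> is empty, where the sum is trivially zero.\<close>
  define \<mu> where "\<mu> = (\<Sum>k\<in>P. y k) / (\<Sum>k\<in>P. t k)"
  define s where "s k = y k - \<mu> * t k" for k
  have zero: "s k = 0" if "k \<in> {1..n}" "t k = 0" for k
    using c[OF that(1)] that(2) by (simp add: s_def t_def)
  have balance: "(\<Sum>k\<in>P. s k) = 0"
  proof (cases "P = {}")
    case False
    then have "0 < (\<Sum>k\<in>P. t k)" by (intro sum_pos) (auto simp: P_def)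
    moreover have "(\<Sum>k\<in>P. s k) = (\<Sum>k\<in>P. y k) - \<mu> * (\<Sum>k\<in>P. t k)"
      by (simp add: s_def sum_subtractf sum_distrib_left)
    ultimately show ?thesis by (simp add: \<mu>_def)
  qed simp
  obtain \<sigma> where \<sigma>: "\<sigma> permutes {1..n}"
    and sorted: "\<And>a b. 1 \<le> a \<Longrightarrow> a \<le> b \<Longrightarrow> b \<le> n \<Longrightarrow>
      direction_class (t (\<sigma> a)) (s (\<sigma> a)) \<le> direction_class (t (\<sigma> b)) (s (\<sigma> b))"
    using exists_sorting_permutation[of n "\<lambda>k. direction_class (t k) (s k)"] by blast
  \<comment> \<open>The order \<open>\<sigma>\<close> was chosen from the projections alone, before
    the heights in \<open>p\<close>; it serves all realizations at once.\<close>
  have "is_unknot (polygon n p)" if p: "realization n (\<lambda>k. proj (w k)) \<sigma> p" "embedded n p" for p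
  proof -
    let ?q = "shear c \<mu> \<circ> p"
    have step: "fst (p k) - fst (p (k - 1)) = x (\<sigma> k)" "fst (snd (p k)) - fst (snd (p (k - 1))) = y (\<sigma> k)"
      if "1 \<le> k" "k \<le> n" for k
      using p(1) that by (auto simp: realization_def proj_def x_def y_def)
    have loop: "simple_loop (polygon n ?q)"
      unfolding polygon_linear_image[OF linear_shear] using p(2)
      by (intro simple_loop_linear_image linear_shear inj_shear) (simp add: embedded_def simple_loop_def)
    have t: "fst (?q k) = fst (?q (k - 1)) + t (\<sigma> k)" if "1 \<le> k" "k \<le> n" for k
      unfolding t_def step[OF that, symmetric] by (simp add: shear_def algebra_simps)
    have s: "fst (snd (?q k)) = fst (snd (?q (k - 1))) + s (\<sigma> k)" if "1 \<le> k" "k \<le> n" for k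
      unfolding s_def t_def step[OF that, symmetric] by (simp add: shear_def algebra_simps)
    have "ambient_isotopic (polygon n ?q) std_circle"
    proof (rule sorted_directions_unknotted[OF loop _ t s sorted])
      show "?q n = ?q 0" using p(1) by (simp add: realization_def)
      show "s (\<sigma> k) = 0" if "1 \<le> k" "k \<le> n" "t (\<sigma> k) = 0" for k
        using zero[of "\<sigma> k"] that permutes_in_image[OF \<sigma>, of k] by simp
      \<comment> \<open>\<open>balance\<close> speaks of indices of vectors, whereas the sorted path
        is indexed by positions; \<open>\<sigma>\<close> identifies the two index sets.\<close>
      have "bij_betw \<sigma> {k \<in> {1..n}. 0 < t (\<sigma> k)} P"
      proof (rule bij_betw_subset[OF permutes_imp_bij[OF \<sigma>]])
        show "\<sigma> ` {k \<in> {1..n}. 0 < t (\<sigma> k)} = P"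
        proof
          show "P \<subseteq> \<sigma> ` {k \<in> {1..n}. 0 < t (\<sigma> k)}"
          proof
            fix k assume k: "k \<in> P"
            then have "k \<in> \<sigma> ` {1..n}" unfolding permutes_image[OF \<sigma>] by (simp add: P_def)
            then obtain m where "m \<in> {1..n}" "k = \<sigma> m" by blast
            then show "k \<in> \<sigma> ` {k \<in> {1..n}. 0 < t (\<sigma> k)}" using k by (auto simp: P_def)
          qed
        qed (use permutes_in_image[OF \<sigma>] in \<open>auto simp: P_def\<close>)
      qed auto
      from sum.reindex_bij_betw[OF this, of s] balance
      show "(\<Sum>k\<in>{k \<in> {1..n}. 0 < t (\<sigma> k)}. s (\<sigma> k)) = 0" by simp
    qed
    then show ?thesis
      unfolding is_unknot_iff polygon_linear_image[OF linear_shear]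
      by (rule ambient_isotopic_trans[OF ambient_isotopic_shear])
  qed
  then show ?thesis using \<sigma> by blast
qed

end
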